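(* Let $\kappa$ be a regular uncountable cardinal, $\chi<\kappa$ an infinite cardinal, $U\subseteq{}^{<\kappa}\kappa$ a downward-closed $\kappa$-tree, and suppose $\mathrm{P}_{14}(\kappa,\sqsubseteq,1,\{E^\kappa_{\ge\chi}\})$ holds. If $\lambda^{<\chi}<\kappa$ for all $\lambda<\kappa$, then there exists a downward-closed $T\subseteq{}^{<\kappa}\kappa$ which is a prolific $\chi$-complete $\kappa$-Souslin tree admitting an injective $(\mathcal F^{\mathrm{fin}}_{\aleph_0},U)$-ascent path.
   Context: Downward-closed subsets of ${}^{<\kappa}\kappa$ are ordered by $\subsetneq$, height is $\mathrm{dom}$, $T_\alpha=T\cap{}^\alpha\kappa$. Prolific: $x^\frown\langle i\rangle\in T$ for all $x\in T_\alpha$, $i<\max\{\omega,\alpha\}$. $\chi$-complete: every increasing sequence of length $<\chi$ has an upper bound. $\kappa$-tree: height $\kappa$, levels of size $<\kappa$; $\kappa$-Souslin: no cofinal branch, no antichain of size $\kappa$. $E^\kappa_{\ge\chi}=\{\alpha<\kappa\mid\mathrm{cf}(\alpha)\ge\chi\}$. $\mathcal F^{\mathrm{fin}}_{\aleph_0}=\{Z\subseteq\omega\mid\omega\setminus Z$ finite$\}$. An $(\mathcal F,U)$-ascent path through $T$ is $\langle f_u\mid u\in U\rangle$ with $f_u:\bigcup\mathcal F\to T_{\mathrm{dom}(u)}$, $\{i\mid f_u(i)\subsetneq f_v(i)\}\in\mathcal F$ for $u\subsetneq v$ in $U$, and $\{i\mid f_u(i)\ne f_v(i)\}\in\mathcal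 F$ for distinct $u,v\in U$ of equal domain; injective if for every $b:\kappa\to\kappa$ with all $b\restriction\alpha\in U$ there are $\alpha<\kappa$, $I\in\mathcal F$ with $f_{b\restriction\alpha}\restriction I$ injective. $\mathrm{P}_{14}(\kappa,\sqsubseteq,1,\{S\})$: $\diamondsuit(\kappa)$ holds and there is $\langle C_\alpha\mid\alpha<\kappa\rangle$ with $C_\alpha$ club in $\alpha$ for limit $\alpha$, $C_{\bar\alpha}=C_\alpha\cap\bar\alpha$ whenever $\bar\alpha\in\mathrm{acc}(C_\alpha)=\{\gamma\in C_\alpha\mid\sup(C_\alpha\cap\gamma)=\gamma>0\}$, and for every cofinal $A\subseteq\kappa$ there are stationarily many $\alpha\in S$ with $\sup\{\beta\in C_\alpha\mid\mathrm{succ}_\omega(C_\alpha\setminus\beta)\subseteq A\}=\alpha$, where $\mathrm{succ}_\omega(D)=\{\delta\in D\mid0<\mathrm{otp}(D\cap\delta)<\omega\}$. *)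

theory Defs
  imports Main "HOL-Library.Equipollence" "HOL-Library.Countable_Set"
begin

(* kappa is represented by a well-ordered type 'k (its elements are the
   ordinals below kappa). A node of ^{<kappa}kappa is a partial map
   'k -> 'k whose domain is an initial segment {..<alpha}. *)

type_synonym 'k node = "'k \<rightharpoonup> 'k"

definition is_node :: "('k::wellorder) node \<Rightarrow> bool" where
  "is_node x \<longleftrightarrow> (\<exists>\<alpha>. dom x = {..<\<alpha>})"

definition level :: "('k::wellorder) node set \<Rightarrow> 'k \<Rightarrow> 'k node set" where
  "level T \<alpha> = {x \<in> T. dom x = {..<\<alpha>}}"

definition downward_closed :: "('k::wellorder) node set \<Rightarrow> bool" where
  "downward_closed T \<longleftrightarrow> (\<forall>x\<in>T. is_node x) \<and>
     (\<forall>x\<in>T. \<forall>y. is_node y \<and> y \<subseteq>\<^sub>m x \<longrightarrow> y \<in> T)"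

definition omega_k :: "'k::wellorder" where
  "omega_k = (LEAST a. infinite {..<a})"

(* x^<i> for x in T_alpha is x(alpha := i) *)
definition prolific :: "('k::wellorder) node set \<Rightarrow> bool" where
  "prolific T \<longleftrightarrow> (\<forall>\<alpha> x i. x \<in> level T \<alpha> \<and> (i < omega_k \<or> i < \<alpha>) \<longrightarrow> x(\<alpha> \<mapsto> i) \<in> T)"

definition chi_complete :: "('k::wellorder) node set \<Rightarrow> 'k \<Rightarrow> bool" where
  "chi_complete T \<chi> \<longleftrightarrow> (\<forall>\<theta> s. \<theta> < \<chi> \<and> (\<forall>i<\<theta>. s i \<in> T) \<and>
       (\<forall>i j. i < j \<and> j < \<theta> \<longrightarrow> s i \<subseteq>\<^sub>m s j \<and> s i \<noteq> s j)
       \<longrightarrow> (\<exists>y\<in>T. \<forall>i<\<theta>. s i \<subseteq>\<^sub>m y))"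

definition kappa_tree :: "('k::wellorder) node set \<Rightarrow> bool" where
  "kappa_tree T \<longleftrightarrow> (\<forall>\<alpha>. level T \<alpha> \<noteq> {}) \<and> (\<forall>\<alpha>. level T \<alpha> \<prec> (UNIV :: 'k set))"

definition cofinal_branch :: "('k::wellorder) node set \<Rightarrow> 'k node set \<Rightarrow> bool" where
  "cofinal_branch T B \<longleftrightarrow> B \<subseteq> T \<and> (\<forall>x\<in>B. \<forall>y\<in>B. x \<subseteq>\<^sub>m y \<or> y \<subseteq>\<^sub>m x) \<and>
     (\<forall>\<alpha>. B \<inter> level T \<alpha> \<noteq> {})"

definition antichain :: "('k::wellorder) node set \<Rightarrow> 'k node set \<Rightarrow> bool" where
  "antichain T A \<longleftrightarrow> A \<subseteq> T \<and>
     (\<forall>x\<in>A. \<forall>y\<in>A. x \<noteq> y \<longrightarrow> \<not> x \<subseteq>\<^sub>m y \<and> \<not> y \<subseteq>\<^sub>m x)"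

definition kappa_souslin :: "('k::wellorder) node set \<Rightarrow> bool" where
  "kappa_souslin T \<longleftrightarrow> kappa_tree T \<and> \<not> (\<exists>B. cofinal_branch T B) \<and>
     \<not> (\<exists>A. antichain T A \<and> A \<approx> (UNIV :: 'k set))"

definition is_limit :: "'k::wellorder \<Rightarrow> bool" where
  "is_limit \<alpha> \<longleftrightarrow> (\<exists>\<beta>. \<beta> < \<alpha>) \<and> (\<forall>\<beta><\<alpha>. \<exists>\<gamma>. \<beta> < \<gamma> \<and> \<gamma> < \<alpha>)"

definition club_in :: "('k::wellorder) set \<Rightarrow> 'k \<Rightarrow> bool" where
  "club_in C \<alpha> \<longleftrightarrow> C \<subseteq> {..<\<alpha>} \<and> (\<forall>\<beta><\<alpha>. \<exists>\<gamma>\<in>C. \<beta> < \<gamma>) \<and>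
     (\<forall>\<delta><\<alpha>. is_limit \<delta> \<and> (\<forall>\<beta><\<delta>. \<exists>\<gamma>\<in>C. \<beta> < \<gamma> \<and> \<gamma> < \<delta>) \<longrightarrow> \<delta> \<in> C)"

definition club :: "('k::wellorder) set \<Rightarrow> bool" where
  "club C \<longleftrightarrow> (\<forall>\<beta>. \<exists>\<gamma>\<in>C. \<beta> < \<gamma>) \<and>
     (\<forall>\<delta>. is_limit \<delta> \<and> (\<forall>\<beta><\<delta>. \<exists>\<gamma>\<in>C. \<beta> < \<gamma> \<and> \<gamma> < \<delta>) \<longrightarrow> \<delta> \<in> C)"

definition stationary :: "('k::wellorder) set \<Rightarrow> bool" where
  "stationary S \<longleftrightarrow> (\<forall>C. club C \<longrightarrow> S \<inter> C \<noteq> {})"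

definition diamond :: "('k::wellorder) itself \<Rightarrow> bool" where
  "diamond _ \<longleftrightarrow> (\<exists>A :: 'k \<Rightarrow> 'k set. (\<forall>\<alpha>. A \<alpha> \<subseteq> {..<\<alpha>}) \<and>
     (\<forall>Z. stationary {\<alpha>. Z \<inter> {..<\<alpha>} = A \<alpha>}))"

definition acc :: "('k::wellorder) set \<Rightarrow> 'k set" where
  "acc C = {\<gamma>\<in>C. (\<exists>\<beta>. \<beta> < \<gamma>) \<and> (\<forall>\<beta><\<gamma>. \<exists>\<delta>\<in>C. \<beta> < \<delta> \<and> \<delta> < \<gamma>)}"

(* succ_omega(D) = {delta in D | 0 < otp(D cap delta) < omega} *)
definition succ_omega :: "('k::wellorder) set \<Rightarrow> 'k set" where
  "succ_omega D = {\<delta>\<in>D. D \<inter> {..<\<delta>} \<noteq> {} \<and> finite (D \<inter> {..<\<delta>})}"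

definition P14 :: "('k::wellorder) set \<Rightarrow> bool" where
  "P14 S \<longleftrightarrow> diamond TYPE('k) \<and>
    (\<exists>C :: 'k \<Rightarrow> 'k set.
       (\<forall>\<alpha>. is_limit \<alpha> \<longrightarrow> club_in (C \<alpha>) \<alpha>) \<and>
       (\<forall>\<alpha>. \<forall>\<alpha>'\<in>acc (C \<alpha>). C \<alpha>' = C \<alpha> \<inter> {..<\<alpha>'}) \<and>
       (\<forall>A. (\<forall>\<beta>. \<exists>\<gamma>\<in>A. \<beta> \<le> \<gamma>) \<longrightarrow>
          stationary {\<alpha>\<in>S. \<forall>\<gamma><\<alpha>. \<exists>\<beta>\<in>C \<alpha>. \<gamma> < \<beta> \<and>
                         succ_omega (C \<alpha> - {..<\<beta>}) \<subseteq> A}))"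

definition cf_ge :: "'k::wellorder \<Rightarrow> 'k \<Rightarrow> bool" where
  "cf_ge \<alpha> \<chi> \<longleftrightarrow> (\<forall>X \<subseteq> {..<\<alpha>}. (\<forall>\<beta><\<alpha>. \<exists>\<gamma>\<in>X. \<beta> \<le> \<gamma>) \<longrightarrow> {..<\<chi>} \<lesssim> X)"

definition E_ge :: "'k::wellorder \<Rightarrow> 'k set" where
  "E_ge \<chi> = {\<alpha>. cf_ge \<alpha> \<chi>}"

definition is_cardinal :: "'k::wellorder \<Rightarrow> bool" where
  "is_cardinal \<chi> \<longleftrightarrow> (\<forall>\<beta><\<chi>. {..<\<beta>} \<prec> {..<\<chi>})"

(* the set of all functions mu -> lambda with mu < chi; its size is lambda^{<chi} *)
definition short_funs :: "'k::wellorder \<Rightarrow> 'k \<Rightarrow> 'k node set" where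
  "short_funs lam \<chi> = {g. \<exists>\<mu><\<chi>. dom g = {..<\<mu>} \<and> ran g \<subseteq> {..<lam}}"

definition Ffin :: "nat set set" where
  "Ffin = {Z. finite (UNIV - Z)}"

definition ascent_path :: "('k::wellorder) node set \<Rightarrow> 'k node set \<Rightarrow> ('k node \<Rightarrow> nat \<Rightarrow> 'k node) \<Rightarrow> bool" where
  "ascent_path T U f \<longleftrightarrow>
     (\<forall>u\<in>U. \<forall>i. f u i \<in> T \<and> dom (f u i) = dom u) \<and>
     (\<forall>u\<in>U. \<forall>v\<in>U. u \<subseteq>\<^sub>m v \<and> u \<noteq> v \<longrightarrow> {i. f u i \<subseteq>\<^sub>m f v i \<and> f u i \<noteq> f v i} \<in> Ffin) \<and>
     (\<forall>u\<in>U. \<forall>v\<in>U. u \<noteq> v \<and> dom u = dom v \<longrightarrow> {i. f u i \<noteq> f v i} \<in> Ffin)"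

definition restr :: "('k::wellorder \<Rightarrow> 'k) \<Rightarrow> 'k \<Rightarrow> 'k node" where
  "restr b \<alpha> = (\<lambda>\<beta>. if \<beta> < \<alpha> then Some (b \<beta>) else None)"

definition injective_ascent :: "('k::wellorder) node set \<Rightarrow> ('k node \<Rightarrow> nat \<Rightarrow> 'k node) \<Rightarrow> bool" where
  "injective_ascent U f \<longleftrightarrow>
     (\<forall>b. (\<forall>\<alpha>. restr b \<alpha> \<in> U) \<longrightarrow> (\<exists>\<alpha>. \<exists>I\<in>Ffin. inj_on (f (restr b \<alpha>)) I))"

end

theory Submission
  imports Defs
begin

text \<open>
  The levels of \<open>T\<close> and the ascent path are built by one recursion on \<open>\<alpha> < \<kappa>\<close>. At a limit \<open>\<alpha>\<close>
  a branch is obtained by walking along the club \<open>C\<^sub>\<alpha>\<close>: at each \<open>\<beta> \<in> C\<^sub>\<alpha>\<close> the walk moves to a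
  prescribed node (a hint) if that node extends what has been built so far, and otherwise to a node
  which, if possible, lies above an element of the set guessed by diamond at \<open>\<beta>\<close>. Coherence of the
  \<open>C\<^sub>\<alpha>\<close> makes the walk at an accumulation point \<open>\<gamma>\<close> of \<open>C\<^sub>\<alpha>\<close> agree with the one that was used at level \<open>\<gamma>\<close>,
  so no walk ever breaks down. The entry \<open>f\<^sub>u(i)\<close> is the walk with hints \<open>f\<^bsub>u\<restriction>\<beta>\<^esub>(i)\<close>, except
  that in every \<open>\<omega>\<close>-block of \<open>C\<^sub>\<alpha>\<close> only the first \<open>i\<close> or so hints are given. For fixed \<open>\<beta>\<close> all but
  finitely many \<open>i\<close> thus follow the hints, which gives the ascent path; for fixed \<open>i\<close> a block on
  which all guesses are correct still seals \<open>f\<^sub>u(i)\<close>. At levels of cofinality below \<open>\<chi>\<close>, where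
  nothing has to be sealed, all branches are added.

  In place of a maximal antichain, diamond guesses the dense set of all nodes that lie above an
  element of the given antichain or are incompatible with all its elements.
\<close>

section \<open>Small sets and clubs\<close>

text \<open>Comparability of cardinals, taken over from the totality of \<open>ordLeq\<close> on the
  well-orders \<open>card_of A\<close> and \<open>card_of B\<close>.\<close>

lemma lesspoll_iff_not_lepoll: "A \<prec> B \<longleftrightarrow> \<not> B \<lesssim> A"
proof -
  have "A \<lesssim> B \<longleftrightarrow> (card_of A, card_of B) \<in> ordLeq" for A :: "'x set" and B :: "'y set"
    unfolding lepoll_def card_of_ordLeq[symmetric] by auto
  moreover have "(card_of A, card_of B) \<in> ordLeq \<or> (card_of B, card_of A) \<in> ordLeq"
    using ordLeq_total[OF card_of_Well_order card_of_Well_order] .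
  ultimately have "A \<lesssim> B \<or> B \<lesssim> A"
    unfolding lepoll_def card_of_ordLeq[symmetric] by auto
  then show ?thesis
    unfolding lesspoll_def using lepoll_antisym eqpoll_imp_lepoll eqpoll_sym by blast
qed

lemma infinite_Times_self_lepoll: "infinite A \<Longrightarrow> A \<times> A \<lesssim> A"
  using card_of_Times_same_infinite[of A] ordIso_iff_ordLeq[of "card_of (A \<times> A)"] card_of_ordLeq[of "A \<times> A" A]
  unfolding lepoll_def by auto

lemma Collect_in_Ffin_iff: "{i. P i} \<in> Ffin \<longleftrightarrow> eventually P cofinite"
  unfolding Ffin_def eventually_cofinite by (simp add: Collect_neg_eq Compl_eq_Diff_UNIV)

lemma is_limit_or_last:
  fixes \<alpha> :: "'k::wellorder"
  assumes "\<beta> < \<alpha>" "\<not> is_limit \<alpha>"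
  obtains p where "{..<\<alpha>} = {..p}"
proof -
  obtain p where p: "p < \<alpha>" "\<And>\<gamma>. \<gamma> < \<alpha> \<Longrightarrow> \<gamma> \<le> p"
    using assms unfolding is_limit_def by (meson not_le)
  then show ?thesis by (intro that[of p]) auto
qed

text \<open>The argument \<open>K\<close> carries the type whose size is \<kappa>, which the type of
  \<open>X\<close> does not determine.\<close>

abbreviation small :: "'k itself \<Rightarrow> 'b set \<Rightarrow> bool"
  where "small K X \<equiv> X \<prec> (UNIV :: 'k set)"

locale regular_uncountable =
  fixes K :: "'k::wellorder itself"
  assumes uncountable_UNIV: "uncountable (UNIV :: 'k set)"
    and lessThan_lesspoll: "{..<a::'k} \<prec> (UNIV :: 'k set)"
    and cofinal_eqpoll: "(\<And>a. \<exists>x\<in>X. (a::'k) \<le> x) \<Longrightarrow> X \<approx> (UNIV :: 'k set)"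
begin

lemma infinite_UNIV: "infinite (UNIV :: 'k set)"
  using uncountable_UNIV countable_finite by blast

lemma small_lepoll: "X \<lesssim> Y \<Longrightarrow> small K Y \<Longrightarrow> small K X"
  by (rule lesspoll_trans1)

lemma small_subset: "X \<subseteq> Y \<Longrightarrow> small K Y \<Longrightarrow> small K X"
  by (rule small_lepoll[OF subset_imp_lepoll])

lemma small_image: "small K X \<Longrightarrow> small K (f ` X)"
  by (rule small_lepoll[OF image_lepoll])

text \<open>Regularity read backwards: an unbounded subset of \<kappa> has size \<kappa>.\<close>

lemma small_bounded:
  assumes "small K (Z :: 'k set)" obtains a where "Z \<subseteq> {..<a}"
proof -
  have "\<not> Z \<approx> (UNIV :: 'k set)"
    using assms unfolding lesspoll_def by blast
  then show ?thesis
    using cofinal_eqpoll[of Z] that by (meson lessThan_iff not_le subsetI)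
qed

text \<open>By regularity the image of an injection into \<kappa> is bounded. Small sets can thus be
  compared with proper initial segments, where common bounds are available.\<close>

lemma small_iff_lepoll_lessThan: "small K X \<longleftrightarrow> (\<exists>a::'k. X \<lesssim> {..<a})"
proof
  assume X: "small K X"
  then obtain g :: "_ \<Rightarrow> 'k" where g: "inj_on g X"
    unfolding lesspoll_def lepoll_def by blast
  obtain a where "g ` X \<subseteq> {..<a}"
    using small_bounded[OF small_image[OF X]] .
  then show "\<exists>a::'k. X \<lesssim> {..<a}"
    using g unfolding lepoll_def by blast
qed (auto intro: small_lepoll[OF _ lessThan_lesspoll])

lemma small_countable: "countable X \<Longrightarrow> small K X"
  unfolding lesspoll_iff_not_lepoll
  using countable_lepoll uncountable_UNIV by blast

text \<open>Both factors inject into one initial segment \<open>M\<close>. An infinite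
  \<open>M\<close> absorbs its square; a finite \<open>M\<close> gives a countable product.\<close>

lemma small_Times:
  assumes "small K X" "small K Y"
  shows "small K (X \<times> Y)"
proof -
  obtain a b :: 'k where ab: "X \<lesssim> {..<a}" "Y \<lesssim> {..<b}"
    using assms[unfolded small_iff_lepoll_lessThan] by auto
  define M where "M = {..<max a b}"
  have "X \<lesssim> M" "Y \<lesssim> M"
    unfolding M_def by (rule lepoll_trans[OF ab(1) subset_imp_lepoll] lepoll_trans[OF ab(2) subset_imp_lepoll], auto)+
  then have XY: "X \<times> Y \<lesssim> M \<times> M"
    by (rule times_lepoll_mono)
  show ?thesis
  proof (cases "finite M")
    case True
    then show ?thesis
      by (intro small_lepoll[OF XY] small_countable) (simp add: countable_finite)
  next
    case False
    then have "M \<times> M \<lesssim> M"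
      by (rule infinite_Times_self_lepoll)
    then show ?thesis
      unfolding M_def by (rule small_lepoll[OF lepoll_trans[OF XY[unfolded M_def]] lessThan_lesspoll])
  qed
qed

text \<open>Regularity gives one initial segment into which all \<open>X i\<close> inject; an
  element of the union is coded by an index and its code inside that set.\<close>

lemma small_UN:
  assumes I: "small K I" and X: "\<And>i. i \<in> I \<Longrightarrow> small K (X i)"
  shows "small K (\<Union>i\<in>I. X i)"
proof -
  have "\<exists>a::'k. X i \<lesssim> {..<a}" if "i \<in> I" for i
    using X[OF that] by (simp add: small_iff_lepoll_lessThan)
  then obtain a :: "_ \<Rightarrow> 'k" where a: "\<And>i. i \<in> I \<Longrightarrow> X i \<lesssim> {..<a i}"
    by metis
  obtain b where b: "a ` I \<subseteq> {..<b}"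
    using small_bounded[OF small_image[OF I]] .
  have "\<exists>g. inj_on g (X i) \<and> g ` X i \<subseteq> {..<b}" if "i \<in> I" for i
  proof -
    have "a i < b" using b that by auto
    then have "{..<a i} \<subseteq> {..<b}" by auto
    with a[OF that] have "X i \<lesssim> {..<b}" by (rule lepoll_trans[OF _ subset_imp_lepoll])
    then show ?thesis by (simp add: lepoll_def)
  qed
  then obtain g where g: "\<And>i. i \<in> I \<Longrightarrow> inj_on (g i) (X i) \<and> g i ` X i \<subseteq> {..<b}"
    by metis
  \<comment> \<open>The sets may overlap, so one index is fixed for each element.\<close>
  define r where "r x = (SOME i. i \<in> I \<and> x \<in> X i)" for x
  have r: "r x \<in> I \<and> x \<in> X (r x)" if "x \<in> (\<Union>i\<in>I. X i)" for x
    unfolding r_def by (rule someI_ex) (use that in auto)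
  have "inj_on (\<lambda>x. (r x, g (r x) x)) (\<Union>i\<in>I. X i)"
    by (rule inj_onI) (metis r g inj_onD prod.inject)
  moreover have "(\<lambda>x. (r x, g (r x) x)) ` (\<Union>i\<in>I. X i) \<subseteq> I \<times> {..<b}"
    using r g by fastforce
  ultimately have "(\<Union>i\<in>I. X i) \<lesssim> I \<times> {..<b}"
    unfolding lepoll_def by blast
  then show ?thesis
    by (rule small_lepoll[OF _ small_Times[OF I lessThan_lesspoll]])
qed

lemma small_Un: "small K X \<Longrightarrow> small K Y \<Longrightarrow> small K (X \<union> Y)"
  using small_UN[of "{True, False}" "\<lambda>b. if b then X else Y"]
  by (simp add: small_countable Un_commute)

lemma small_atMost: "small K {..a::'k}"
  using small_Un[OF lessThan_lesspoll[of a] small_countable[of "{a}"]]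
  by (simp add: ivl_disj_un_singleton(2)[of a, symmetric])

lemma ex_greater: "\<exists>b. (a::'k) < b"
  using small_bounded[OF small_atMost[of a]] by (metis atMost_iff lessThan_iff order_refl subsetD)

definition osuc :: "'k \<Rightarrow> 'k"
  where "osuc a = (LEAST b. a < b)"

lemma less_osuc: "a < osuc a"
  unfolding osuc_def by (rule LeastI_ex[OF ex_greater])

lemma lessThan_osuc: "{..<osuc a} = {..a}"
  using less_osuc[of a] not_less_Least[of _ "\<lambda>b. a < b"] unfolding osuc_def
  by (auto simp: not_less)

lemma osuc_le: "a < b \<Longrightarrow> osuc a \<le> b"
  unfolding osuc_def by (rule Least_le)

lemma ex_pairing: "\<exists>p :: 'k \<times> 'k \<Rightarrow> 'k. inj p"
  using infinite_Times_self_lepoll[OF infinite_UNIV] unfolding lepoll_def by auto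

lemma ex_nat_injection: "\<exists>e :: nat \<Rightarrow> 'k. inj e"
  using infinite_countable_subset[OF infinite_UNIV] by auto

text \<open>For unboundedness, iterate a function that jumps above all earlier values of
  \<open>F\<close>. The supremum of the \<omega> iterates stays below \<kappa>, since countable
  subsets of \<kappa> are bounded.\<close>

lemma club_closed_under:
  fixes F :: "'k \<Rightarrow> 'k"
  shows "club {\<delta>. a < \<delta> \<and> is_limit \<delta> \<and> (\<forall>\<gamma><\<delta>. F \<gamma> < \<delta>)}" (is "club ?D")
  unfolding club_def
proof (intro conjI allI impI)
  fix \<beta> :: 'k
  have "\<exists>e. max a b < e \<and> (\<forall>\<gamma><b. F \<gamma> < e)" for b
  proof -
    obtain e where "{max a b} \<union> F ` {..<b} \<subseteq> {..<e}"
      by (rule small_bounded[OF small_Un[OF small_countable[of "{max a b}"] small_image[OF lessThan_lesspoll, of F b]]])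
        (auto intro: countable_finite)
    then show ?thesis by (intro exI[of _ e]) auto
  qed
  then obtain G where G: "\<And>b. max a b < G b" "\<And>b \<gamma>. \<gamma> < b \<Longrightarrow> F \<gamma> < G b"
    by metis
  define x where "x n = (G ^^ n) (osuc \<beta>)" for n :: nat
  have x_Suc: "x (Suc n) = G (x n)" for n by (simp add: x_def)
  define \<delta> where "\<delta> = (LEAST d. \<forall>n. x n < d)"
  have ub: "x n < \<delta>" for n
  proof -
    obtain d where "range x \<subseteq> {..<d}"
      using small_bounded small_countable by (metis countable_image countableI_type)
    then have "\<forall>n. x n < d" by auto
    then show ?thesis unfolding \<delta>_def by (rule LeastI2) auto
  qed
  have least: "\<exists>n. \<gamma> < x n" if "\<gamma> < \<delta>" for \<gamma>
  proof -
    have "\<not> (\<forall>n. x n < \<gamma>)"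
      using that not_less_Least[of \<gamma> "\<lambda>d. \<forall>n. x n < d"] unfolding \<delta>_def by blast
    then obtain n where "\<gamma> \<le> x n" by (meson not_le)
    also have "x n < x (Suc n)" using G(1)[of "x n"] by (simp add: x_Suc)
    finally show ?thesis by blast
  qed
  have "\<beta> < \<delta>" using ub[of 0] less_osuc[of \<beta>] by (simp add: x_def)
  moreover have "a < \<delta>" using ub[of 1] G(1)[of "x 0"] by (simp add: x_Suc) (metis less_trans)
  moreover have "is_limit \<delta>"
    unfolding is_limit_def using ub least by blast
  moreover have "F \<gamma> < \<delta>" if "\<gamma> < \<delta>" for \<gamma>
    using least[OF that] G(2) ub by (metis less_trans x_Suc)
  ultimately show "\<exists>\<gamma>\<in>?D. \<beta> < \<gamma>" by blast
next
  fix \<delta> :: 'k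
  assume "is_limit \<delta> \<and> (\<forall>\<beta><\<delta>. \<exists>\<gamma>\<in>?D. \<beta> < \<gamma> \<and> \<gamma> < \<delta>)"
  then have "is_limit \<delta>" and D: "\<And>\<beta>. \<beta> < \<delta> \<Longrightarrow> \<exists>\<gamma>\<in>?D. \<beta> < \<gamma> \<and> \<gamma> < \<delta>"
    by auto
  moreover have "a < \<delta>"
    using D \<open>is_limit \<delta>\<close> unfolding is_limit_def by fastforce
  moreover have "F \<gamma> < \<delta>" if "\<gamma> < \<delta>" for \<gamma>
    using D[OF that] by fastforce
  ultimately show "\<delta> \<in> ?D" by blast
qed

end

section \<open>Walks along a club\<close>

text \<open>The union of the nodes \<open>w \<gamma>\<close> for \<gamma> in \<open>C\<close> below
  \<beta>. Reading the value at \<xi> from the least \<gamma> beyond \<xi> gives a function for any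
  \<open>w\<close>, even before the \<open>w \<gamma>\<close> are known to increase.\<close>

definition glue :: "'k::wellorder set \<Rightarrow> ('k \<Rightarrow> 'k node) \<Rightarrow> 'k \<Rightarrow> 'k node"
  where "glue C w \<beta> = (\<lambda>\<xi>. if \<exists>\<gamma>\<in>C. \<xi> < \<gamma> \<and> \<gamma> < \<beta>
    then w (LEAST \<gamma>. \<gamma> \<in> C \<and> \<xi> < \<gamma> \<and> \<gamma> < \<beta>) \<xi> else None)"

definition tower :: "'k::wellorder set \<Rightarrow> ('k \<Rightarrow> 'k node) \<Rightarrow> 'k \<Rightarrow> bool"
  where "tower C w \<beta> \<longleftrightarrow> (\<forall>\<gamma>\<in>C. \<gamma> < \<beta> \<longrightarrow> dom (w \<gamma>) = {..<\<gamma>}) \<and>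
    (\<forall>\<gamma>\<in>C. \<forall>\<delta>\<in>C. \<gamma> < \<delta> \<and> \<delta> < \<beta> \<longrightarrow> w \<gamma> \<subseteq>\<^sub>m w \<delta>)"

text \<open>The glued node sees \<open>C\<close> and \<open>w\<close> only below \<beta>. This
  justifies the recursion for \<open>walk\<close> and lets walks along coherent clubs be
  compared.\<close>

lemma glue_cong:
  assumes "C \<inter> {..<\<beta>} = C' \<inter> {..<\<beta>}" "\<And>\<gamma>. \<gamma> \<in> C \<Longrightarrow> \<gamma> < \<beta> \<Longrightarrow> w \<gamma> = w' \<gamma>"
  shows "glue C w \<beta> = glue C' w' \<beta>"
proof
  fix \<xi>
  let ?P = "\<lambda>C \<gamma>. \<gamma> \<in> C \<and> \<xi> < \<gamma> \<and> \<gamma> < \<beta>"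
  have P: "?P C' = ?P C" using assms(1) by auto
  show "glue C w \<beta> \<xi> = glue C' w' \<beta> \<xi>"
  proof (cases "\<exists>\<gamma>. ?P C \<gamma>")
    case True
    then have "?P C (LEAST \<gamma>. ?P C \<gamma>)" by (rule LeastI_ex)
    then have "w (LEAST \<gamma>. ?P C \<gamma>) = w' (LEAST \<gamma>. ?P C \<gamma>)" using assms(2) by blast
    moreover have "\<exists>\<gamma>. ?P C' \<gamma>" using True P by metis
    ultimately show ?thesis using True P unfolding glue_def by (simp add: Bex_def)
  next
    case False
    moreover have "\<not> (\<exists>\<gamma>. ?P C' \<gamma>)" using False P by metis
    ultimately have "glue C w \<beta> \<xi> = None" "glue C' w' \<beta> \<xi> = None"
      unfolding glue_def by auto
    then show ?thesis by simp
  qed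
qed

lemma glue_least:
  assumes "\<And>\<gamma>. \<gamma> \<in> C \<Longrightarrow> \<gamma> < \<beta> \<Longrightarrow> w \<gamma> \<subseteq>\<^sub>m y"
  shows "glue C w \<beta> \<subseteq>\<^sub>m y"
  unfolding map_le_def
proof
  fix \<xi> assume "\<xi> \<in> dom (glue C w \<beta>)"
  then have ex: "\<exists>\<gamma>. \<gamma> \<in> C \<and> \<xi> < \<gamma> \<and> \<gamma> < \<beta>"
    unfolding glue_def by (auto split: if_splits)
  define \<gamma> where "\<gamma> = (LEAST \<gamma>. \<gamma> \<in> C \<and> \<xi> < \<gamma> \<and> \<gamma> < \<beta>)"
  have "\<gamma> \<in> C" "\<gamma> < \<beta>"
    unfolding \<gamma>_def using LeastI_ex[OF ex] by auto
  moreover have "glue C w \<beta> \<xi> = w \<gamma> \<xi>"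
    using ex unfolding glue_def \<gamma>_def by auto
  ultimately show "glue C w \<beta> \<xi> = y \<xi>"
    using assms \<open>\<xi> \<in> dom (glue C w \<beta>)\<close> unfolding map_le_def by (metis domIff)
qed

lemma glue_upper:
  assumes "tower C w \<beta>" "\<gamma> \<in> C" "\<gamma> < \<beta>"
  shows "w \<gamma> \<subseteq>\<^sub>m glue C w \<beta>"
  unfolding map_le_def
proof
  fix \<xi> assume "\<xi> \<in> dom (w \<gamma>)"
  then have \<xi>: "\<xi> < \<gamma>" using assms unfolding tower_def by auto
  define \<delta> where "\<delta> = (LEAST \<gamma>. \<gamma> \<in> C \<and> \<xi> < \<gamma> \<and> \<gamma> < \<beta>)"
  have P: "\<gamma> \<in> C \<and> \<xi> < \<gamma> \<and> \<gamma> < \<beta>" using \<xi> assms by blast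
  have \<delta>: "\<delta> \<in> C" "\<xi> < \<delta>" "\<delta> < \<beta>" "\<delta> \<le> \<gamma>"
    unfolding \<delta>_def using LeastI[of "\<lambda>\<gamma>. \<gamma> \<in> C \<and> \<xi> < \<gamma> \<and> \<gamma> < \<beta>", OF P]
      Least_le[of "\<lambda>\<gamma>. \<gamma> \<in> C \<and> \<xi> < \<gamma> \<and> \<gamma> < \<beta>", OF P] by auto
  have "w \<delta> \<subseteq>\<^sub>m w \<gamma>"
    using assms \<delta> unfolding tower_def by (cases "\<delta> = \<gamma>") auto
  moreover have "\<xi> \<in> dom (w \<delta>)" using assms(1) \<delta> unfolding tower_def by auto
  ultimately have "w \<delta> \<xi> = w \<gamma> \<xi>" unfolding map_le_def by blast
  moreover have "glue C w \<beta> \<xi> = w \<delta> \<xi>"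
    using P unfolding glue_def \<delta>_def by auto
  ultimately show "w \<gamma> \<xi> = glue C w \<beta> \<xi>" by simp
qed

lemma dom_glue:
  assumes t: "tower C w \<beta>" and "\<And>\<xi>. \<xi> < \<beta> \<Longrightarrow> \<exists>\<gamma>\<in>C. \<xi> < \<gamma> \<and> \<gamma> < \<beta>"
  shows "dom (glue C w \<beta>) = {..<\<beta>}"
proof
  show "dom (glue C w \<beta>) \<subseteq> {..<\<beta>}"
    unfolding glue_def by (auto split: if_splits)
  show "{..<\<beta>} \<subseteq> dom (glue C w \<beta>)"
  proof
    fix \<xi> assume "\<xi> \<in> {..<\<beta>}"
    then obtain \<gamma> where g: "\<gamma> \<in> C" "\<xi> < \<gamma>" "\<gamma> < \<beta>" using assms by auto
    then have "\<xi> \<in> dom (w \<gamma>)" using t unfolding tower_def by auto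
    then show "\<xi> \<in> dom (glue C w \<beta>)"
      using map_le_implies_dom_le[OF glue_upper[OF t g(1,3)]] by blast
  qed
qed

text \<open>\<open>SOME\<close> makes the choice a function of \<open>N\<close>,
  \<open>\<Omega>\<close> and \<open>s\<close> alone, so walks that agree so far and see the same
  data continue to agree.\<close>

definition seal :: "'k node set \<Rightarrow> 'k node set \<Rightarrow> 'k node \<Rightarrow> 'k node"
  where "seal N \<Omega> s =
    (if \<exists>z\<in>N. s \<subseteq>\<^sub>m z \<and> (\<exists>a\<in>\<Omega>. a \<subseteq>\<^sub>m z)
     then SOME z. z \<in> N \<and> s \<subseteq>\<^sub>m z \<and> (\<exists>a\<in>\<Omega>. a \<subseteq>\<^sub>m z)
     else SOME z. z \<in> N \<and> s \<subseteq>\<^sub>m z)"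

lemma seal_extends:
  assumes "\<exists>z\<in>N. s \<subseteq>\<^sub>m z"
  shows "seal N \<Omega> s \<in> N \<and> s \<subseteq>\<^sub>m seal N \<Omega> s"
proof (cases "\<exists>z\<in>N. s \<subseteq>\<^sub>m z \<and> (\<exists>a\<in>\<Omega>. a \<subseteq>\<^sub>m z)")
  case True
  then have "\<exists>z. z \<in> N \<and> s \<subseteq>\<^sub>m z \<and> (\<exists>a\<in>\<Omega>. a \<subseteq>\<^sub>m z)" by blast
  from someI_ex[OF this] show ?thesis using True unfolding seal_def by auto
next
  case False
  have "\<exists>z. z \<in> N \<and> s \<subseteq>\<^sub>m z" using assms by blast
  from someI_ex[OF this] show ?thesis using False unfolding seal_def by auto
qed

lemma seal_meets:
  assumes "\<exists>z\<in>N. s \<subseteq>\<^sub>m z \<and> (\<exists>a\<in>\<Omega>. a \<subseteq>\<^sub>m z)"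
  shows "\<exists>a\<in>\<Omega>. a \<subseteq>\<^sub>m seal N \<Omega> s"
proof -
  have "\<exists>z. z \<in> N \<and> s \<subseteq>\<^sub>m z \<and> (\<exists>a\<in>\<Omega>. a \<subseteq>\<^sub>m z)" using assms by blast
  from someI_ex[OF this] show ?thesis using assms unfolding seal_def by auto
qed

text \<open>A hint that fails to extend \<open>s\<close> is dropped in favour of
  \<open>seal\<close>, so a bad hint never blocks the walk.\<close>

definition pick :: "'k node set \<Rightarrow> 'k node set \<Rightarrow> 'k node option \<Rightarrow> 'k node \<Rightarrow> 'k node"
  where "pick N \<Omega> h s = (case h of Some y \<Rightarrow> if s \<subseteq>\<^sub>m y then y else seal N \<Omega> s | None \<Rightarrow> seal N \<Omega> s)"

lemma pick_Some: "s \<subseteq>\<^sub>m y \<Longrightarrow> pick N \<Omega> (Some y) s = y"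
  and pick_None: "pick N \<Omega> None s = seal N \<Omega> s"
  by (simp_all add: pick_def)

lemma pick_extends:
  assumes "\<exists>z\<in>N. s \<subseteq>\<^sub>m z" "\<And>y. h = Some y \<Longrightarrow> y \<in> N"
  shows "pick N \<Omega> h s \<in> N \<and> s \<subseteq>\<^sub>m pick N \<Omega> h s"
  using assms seal_extends[OF assms(1)] unfolding pick_def by (auto split: option.splits)

definition walk :: "'k::wellorder set \<Rightarrow> ('k \<Rightarrow> 'k node set) \<Rightarrow> ('k \<Rightarrow> 'k node set) \<Rightarrow>
    ('k \<Rightarrow> 'k node option) \<Rightarrow> 'k \<Rightarrow> 'k node"
  where "walk C L \<Omega> H = wfrec {(\<beta>, \<gamma>). \<beta> < \<gamma>}
    (\<lambda>w \<beta>. pick (L \<beta>) (\<Omega> \<beta>) (H \<beta>) (glue C w \<beta>))"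

lemma walk_eq: "walk C L \<Omega> H \<beta> = pick (L \<beta>) (\<Omega> \<beta>) (H \<beta>) (glue C (walk C L \<Omega> H) \<beta>)"
proof -
  have "adm_wf {(\<beta>, \<gamma>). \<beta> < \<gamma>} (\<lambda>w \<beta>. pick (L \<beta>) (\<Omega> \<beta>) (H \<beta>) (glue C w \<beta>))"
    unfolding adm_wf_def by (auto intro!: arg_cong[where f = "pick _ _ _"] glue_cong)
  from wfrec_fixpoint[OF wf this] show ?thesis
    unfolding walk_def by metis
qed

text \<open>The form in which coherence acts: equal initial parts of the clubs and equal data give
  equal walks. Through \<open>glue_walk_cong\<close> it is applied at accumulation points of the
  larger club.\<close>

lemma walk_cong:
  assumes "C \<inter> {..<\<alpha>} = C' \<inter> {..<\<alpha>}"
    and "\<And>\<gamma>. \<gamma> \<in> C \<Longrightarrow> \<gamma> < \<alpha> \<Longrightarrow> L \<gamma> = L' \<gamma> \<and> \<Omega> \<gamma> = \<Omega>' \<gamma> \<and> H \<gamma> = H' \<gamma>"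
    and "\<beta> \<in> C" "\<beta> < \<alpha>"
  shows "walk C L \<Omega> H \<beta> = walk C' L' \<Omega>' H' \<beta>"
  using assms(3,4)
proof (induction \<beta> rule: less_induct)
  case (less \<beta>)
  have "glue C (walk C L \<Omega> H) \<beta> = glue C' (walk C' L' \<Omega>' H') \<beta>"
  proof (rule glue_cong)
    show "C \<inter> {..<\<beta>} = C' \<inter> {..<\<beta>}" using assms(1) less.prems by fastforce
  qed (use less in auto)
  then show ?case
    using assms(2)[OF less.prems] walk_eq[of C L] walk_eq[of C' L'] by metis
qed

lemma glue_walk_cong:
  assumes "C \<inter> {..<\<alpha>} = C' \<inter> {..<\<alpha>}"
    and "\<And>\<gamma>. \<gamma> \<in> C \<Longrightarrow> \<gamma> < \<alpha> \<Longrightarrow> L \<gamma> = L' \<gamma> \<and> \<Omega> \<gamma> = \<Omega>' \<gamma> \<and> H \<gamma> = H' \<gamma>"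
  shows "glue C (walk C L \<Omega> H) \<alpha> = glue C' (walk C' L' \<Omega>' H') \<alpha>"
  by (rule glue_cong[OF assms(1) walk_cong[OF assms]])

text \<open>By induction the node glued so far is a part of \<open>x\<close>, hence each hint is
  accepted.\<close>

lemma walk_follows_hints:
  assumes "\<And>\<gamma>. \<gamma> \<in> C \<Longrightarrow> \<gamma> \<le> \<beta> \<Longrightarrow> H \<gamma> = Some (x |` {..<\<gamma>})" "\<beta> \<in> C"
  shows "walk C L \<Omega> H \<beta> = x |` {..<\<beta>}"
  using assms
proof (induction \<beta> rule: less_induct)
  case (less \<beta>)
  have "glue C (walk C L \<Omega> H) \<beta> \<subseteq>\<^sub>m x |` {..<\<beta>}"
  proof (rule glue_least)
    fix \<gamma> assume "\<gamma> \<in> C" "\<gamma> < \<beta>"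
    then have "walk C L \<Omega> H \<gamma> = x |` {..<\<gamma>}"
      using less by auto
    then show "walk C L \<Omega> H \<gamma> \<subseteq>\<^sub>m x |` {..<\<beta>}"
      using \<open>\<gamma> < \<beta>\<close> by (auto simp: map_le_def restrict_map_def)
  qed
  then show ?case
    using less.prems by (simp add: walk_eq[of C L \<Omega> H \<beta>] pick_Some)
qed

text \<open>Conditions that keep a walk inside the levels. Between successive points of
  \<open>C\<close> it suffices that nodes extend upwards. At an accumulation point the glued node is
  a genuine limit and must already belong to the level; \<open>at_acc\<close> demands this, and
  coherence supplies it later.\<close>

locale walk_system =
  fixes \<alpha> :: "'k::wellorder" and C L \<Omega> H
  assumes club: "club_in C \<alpha>"
    and dom_L: "\<beta> < \<alpha> \<Longrightarrow> x \<in> L \<beta> \<Longrightarrow> dom x = {..<\<beta>}"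
    and extend_L: "\<beta> \<le> \<gamma> \<Longrightarrow> \<gamma> < \<alpha> \<Longrightarrow> x \<in> L \<beta> \<Longrightarrow> \<exists>y\<in>L \<gamma>. x \<subseteq>\<^sub>m y"
    and L_nonempty: "\<beta> < \<alpha> \<Longrightarrow> L \<beta> \<noteq> {}"
    and hint: "\<gamma> \<in> C \<Longrightarrow> H \<gamma> = Some y \<Longrightarrow> y \<in> L \<gamma>"
    and at_acc: "\<gamma> \<in> acc C \<Longrightarrow> glue C (walk C L \<Omega> H) \<gamma> \<in> L \<gamma>"
begin

section \<open>Walks that stay inside the levels\<close>

abbreviation "w \<equiv> walk C L \<Omega> H"

lemma C_less: "\<gamma> \<in> C \<Longrightarrow> \<gamma> < \<alpha>"
  using club unfolding club_in_def by auto

text \<open>The least bound \<beta> of the part of \<open>C\<close> below \<gamma> is itself below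
  \<gamma>, as \<gamma> is no accumulation point. Outside \<open>C\<close> it would be a limit of
  points of \<open>C\<close>, against closedness.\<close>

lemma last_before:
  assumes "\<gamma> \<in> C" "\<gamma> \<notin> acc C" "\<delta> \<in> C" "\<delta> < \<gamma>"
  obtains \<beta> where "\<beta> \<in> C" "\<beta> < \<gamma>" "\<And>\<epsilon>. \<epsilon> \<in> C \<Longrightarrow> \<epsilon> < \<gamma> \<Longrightarrow> \<epsilon> \<le> \<beta>"
proof -
  define P where "P \<beta> \<longleftrightarrow> (\<forall>\<epsilon>\<in>C. \<epsilon> < \<gamma> \<longrightarrow> \<epsilon> \<le> \<beta>)" for \<beta>
  obtain b where b: "b < \<gamma>" "P b"
    using assms unfolding acc_def P_def by (smt (verit, best) mem_Collect_eq not_less)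
  define \<beta> where "\<beta> = (LEAST b. P b)"
  have P: "P \<beta>" unfolding \<beta>_def using b(2) by (rule LeastI)
  have "\<beta> < \<gamma>" unfolding \<beta>_def using Least_le[of P, OF b(2)] b(1) by (rule le_less_trans)
  have "\<beta> \<in> C"
  proof (rule ccontr)
    assume "\<beta> \<notin> C"
    have *: "\<exists>\<epsilon>\<in>C. \<xi> < \<epsilon> \<and> \<epsilon> < \<beta>" if "\<xi> < \<beta>" for \<xi>
    proof -
      have "\<not> P \<xi>" using not_less_Least[OF that[unfolded \<beta>_def]] .
      then obtain \<epsilon> where "\<epsilon> \<in> C" "\<epsilon> < \<gamma>" "\<xi> < \<epsilon>" unfolding P_def by auto
      moreover have "\<epsilon> \<le> \<beta>" using P calculation unfolding P_def by blast
      ultimately show ?thesis using \<open>\<beta> \<notin> C\<close> by (metis order.order_iff_strict)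
    qed
    \<comment> \<open>The point \<delta> ensures that \<beta> is not zero, which
      \<open>is_limit\<close> excludes.\<close>
    moreover have "\<delta> < \<beta>"
      using P assms \<open>\<beta> \<notin> C\<close> unfolding P_def by (metis order.order_iff_strict)
    ultimately have "is_limit \<beta>" unfolding is_limit_def by blast
    moreover have "\<beta> < \<alpha>" using \<open>\<beta> < \<gamma>\<close> C_less[OF assms(1)] by simp
    ultimately show False using club * \<open>\<beta> \<notin> C\<close> unfolding club_in_def by blast
  qed
  then show ?thesis using that P \<open>\<beta> < \<gamma>\<close> unfolding P_def by blast
qed

lemma glue_last:
  assumes "tower C w \<gamma>" "\<beta> \<in> C" "\<beta> < \<gamma>" "\<And>\<epsilon>. \<epsilon> \<in> C \<Longrightarrow> \<epsilon> < \<gamma> \<Longrightarrow> \<epsilon> \<le> \<beta>"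
  shows "glue C w \<gamma> = w \<beta>"
proof (rule map_le_antisym)
  show "glue C w \<gamma> \<subseteq>\<^sub>m w \<beta>"
  proof (rule glue_least)
    fix \<epsilon> assume "\<epsilon> \<in> C" "\<epsilon> < \<gamma>"
    then have "\<epsilon> = \<beta> \<or> \<epsilon> < \<beta>" using assms(4) by (auto simp: order.order_iff_strict)
    then show "w \<epsilon> \<subseteq>\<^sub>m w \<beta>"
      using assms(1-3) \<open>\<epsilon> \<in> C\<close> unfolding tower_def by auto
  qed
  show "w \<beta> \<subseteq>\<^sub>m glue C w \<gamma>" by (rule glue_upper[OF assms(1-3)])
qed

text \<open>Induction along \<open>C\<close>. The glued node extends to level \<gamma> for one of
  three reasons: \<gamma> is an accumulation point and \<open>at_acc\<close> applies; \<gamma> has a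
  predecessor in \<open>C\<close>, whose node is the glued one; or \<gamma> is the first point and
  nothing has been glued.\<close>

lemma walk_invariant:
  assumes "\<gamma> \<in> C"
  shows "w \<gamma> \<in> L \<gamma> \<and> glue C w \<gamma> \<subseteq>\<^sub>m w \<gamma> \<and> tower C w \<gamma>"
  using assms
proof (induction \<gamma> rule: less_induct)
  case (less \<gamma>)
  have tow: "tower C w \<gamma>"
    unfolding tower_def
  proof (intro conjI ballI impI)
    fix \<delta> assume "\<delta> \<in> C" "\<delta> < \<gamma>"
    then show "dom (w \<delta>) = {..<\<delta>}" using less dom_L C_less by blast
  next
    fix \<delta> \<epsilon> assume *: "\<delta> \<in> C" "\<epsilon> \<in> C" "\<delta> < \<epsilon> \<and> \<epsilon> < \<gamma>"
    then have "tower C w \<epsilon>" "glue C w \<epsilon> \<subseteq>\<^sub>m w \<epsilon>" using less by auto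
    then show "w \<delta> \<subseteq>\<^sub>m w \<epsilon>" using map_le_trans[OF glue_upper[of C w \<epsilon> \<delta>]] * by blast
  qed
  have "\<exists>z\<in>L \<gamma>. glue C w \<gamma> \<subseteq>\<^sub>m z"
  proof (cases "\<gamma> \<in> acc C")
    case True
    then show ?thesis using at_acc map_le_refl by blast
  next
    case nacc: False
    show ?thesis
    proof (cases "\<exists>\<delta>\<in>C. \<delta> < \<gamma>")
      case True
      then obtain \<beta> where b: "\<beta> \<in> C" "\<beta> < \<gamma>" "\<And>\<epsilon>. \<epsilon> \<in> C \<Longrightarrow> \<epsilon> < \<gamma> \<Longrightarrow> \<epsilon> \<le> \<beta>"
        using last_before[OF less.prems nacc] by metis
      have "w \<beta> \<in> L \<beta>" using less b by blast
      then show ?thesis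
        using glue_last[OF tow b] extend_L[of \<beta> \<gamma>] b(2) C_less[OF less.prems] by auto
    next
      case False
      then have "glue C w \<gamma> \<subseteq>\<^sub>m z" for z by (intro glue_least) auto
      then show ?thesis using L_nonempty[OF C_less[OF less.prems]] by blast
    qed
  qed
  from pick_extends[OF this, of "H \<gamma>" "\<Omega> \<gamma>"] show ?case
    using tow hint[OF less.prems] walk_eq[of C L \<Omega> H \<gamma>] by metis
qed

lemma tower_walk: "tower C w \<alpha>"
  unfolding tower_def
proof (intro conjI ballI impI)
  fix \<gamma> assume "\<gamma> \<in> C"
  then show "dom (w \<gamma>) = {..<\<gamma>}" using walk_invariant dom_L C_less by blast
next
  fix \<gamma> \<delta> assume *: "\<gamma> \<in> C" "\<delta> \<in> C" "\<gamma> < \<delta> \<and> \<delta> < \<alpha>"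
  have "w \<gamma> \<subseteq>\<^sub>m glue C w \<delta>" using glue_upper[of C w \<delta> \<gamma>] walk_invariant[of \<delta>] * by blast
  moreover have "glue C w \<delta> \<subseteq>\<^sub>m w \<delta>" using walk_invariant[of \<delta>] * by blast
  ultimately show "w \<gamma> \<subseteq>\<^sub>m w \<delta>" by (rule map_le_trans)
qed

lemma dom_limit: "dom (glue C w \<alpha>) = {..<\<alpha>}"
  using club C_less by (intro dom_glue[OF tower_walk]) (auto simp: club_in_def)

lemma walk_le_limit: "\<gamma> \<in> C \<Longrightarrow> w \<gamma> \<subseteq>\<^sub>m glue C w \<alpha>"
  using glue_upper[OF tower_walk] C_less by blast

lemma limit_restrict:
  assumes "\<gamma> \<in> C"
  shows "glue C w \<alpha> |` {..<\<gamma>} = w \<gamma>"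
proof
  fix \<xi>
  have "dom (w \<gamma>) = {..<\<gamma>}" using assms walk_invariant dom_L C_less by blast
  then show "(glue C w \<alpha> |` {..<\<gamma>}) \<xi> = w \<gamma> \<xi>"
    using walk_le_limit[OF assms] unfolding map_le_def restrict_map_def
    by (metis domIff lessThan_iff)
qed

text \<open>The walk reaches \<gamma> from its node at the preceding point of \<open>C\<close>.
  Density puts an element of the guess above this node at a level below \<gamma>, and that element
  extends to level \<gamma>; so the preferred choice of \<open>seal\<close> is available.\<close>

lemma walk_meets:
  assumes \<gamma>: "\<gamma> \<in> C" "\<gamma> \<notin> acc C" "\<delta> \<in> C" "\<delta> < \<gamma>" and "H \<gamma> = None"
    and dense: "\<And>\<beta> y. \<beta> < \<gamma> \<Longrightarrow> y \<in> L \<beta> \<Longrightarrow> \<exists>\<epsilon><\<gamma>. \<exists>z\<in>L \<epsilon>. z \<in> \<Omega> \<gamma> \<and> y \<subseteq>\<^sub>m z"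
  shows "\<exists>a\<in>\<Omega> \<gamma>. a \<subseteq>\<^sub>m w \<gamma>"
proof -
  obtain \<beta> where b: "\<beta> \<in> C" "\<beta> < \<gamma>" "\<And>\<epsilon>. \<epsilon> \<in> C \<Longrightarrow> \<epsilon> < \<gamma> \<Longrightarrow> \<epsilon> \<le> \<beta>"
    using last_before[OF \<gamma>] by metis
  have glue: "glue C w \<gamma> = w \<beta>"
    using glue_last[OF _ b] walk_invariant[OF \<gamma>(1)] by blast
  obtain \<epsilon> z where z: "\<epsilon> < \<gamma>" "z \<in> L \<epsilon>" "z \<in> \<Omega> \<gamma>" "w \<beta> \<subseteq>\<^sub>m z"
    using dense[OF b(2)] walk_invariant[OF b(1)] by blast
  obtain z' where "z' \<in> L \<gamma>" "z \<subseteq>\<^sub>m z'"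
    using extend_L[of \<epsilon> \<gamma> z] z(1,2) C_less[OF \<gamma>(1)] by (meson less_imp_le)
  then have "\<exists>z'\<in>L \<gamma>. w \<beta> \<subseteq>\<^sub>m z' \<and> (\<exists>a\<in>\<Omega> \<gamma>. a \<subseteq>\<^sub>m z')"
    using z map_le_trans by blast
  from seal_meets[OF this] show ?thesis
    using assms(5) glue walk_eq[of C L \<Omega> H \<gamma>] by (simp add: pick_None)
qed

end

section \<open>Construction of the tree\<close>

lemma restrict_lessThan_self: "dom x = {..<\<alpha>} \<Longrightarrow> x |` {..<\<alpha>} = x"
  by (metis map_le_antisym map_le_def restrict_in domIff restrict_out)

lemma dom_restrict_lessThan: "dom x = {..<\<alpha>} \<Longrightarrow> \<beta> \<le> \<alpha> \<Longrightarrow> dom (x |` {..<\<beta>}) = {..<(\<beta>::'k::linorder)}"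
  by auto

lemma restrict_map_le: "x |` A \<subseteq>\<^sub>m x"
  by (simp add: map_le_def)

lemma map_le_iff_restrict: "dom x = A \<Longrightarrow> x \<subseteq>\<^sub>m y \<longleftrightarrow> y |` A = x"
proof
  assume "dom x = A" "x \<subseteq>\<^sub>m y"
  then show "y |` A = x"
    by (intro ext) (auto simp: map_le_def restrict_map_def domIff)
qed (metis restrict_map_le)

lemma acc_is_limit: "\<gamma> \<in> acc D \<Longrightarrow> is_limit \<gamma>"
  unfolding acc_def is_limit_def by blast

definition height :: "('k::wellorder) node \<Rightarrow> 'k"
  where "height x = (THE \<alpha>. dom x = {..<\<alpha>})"

lemma height_eq: "dom x = {..<\<alpha>} \<Longrightarrow> height x = \<alpha>"
  unfolding height_def by auto

text \<open>The position of \<open>\<beta>\<close> inside its \<open>\<omega>\<close>-block of \<open>D\<close>.\<close>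

definition block_pos :: "('k::wellorder) set \<Rightarrow> 'k \<Rightarrow> nat"
  where "block_pos D \<beta> = card {\<gamma>\<in>D. \<gamma> < \<beta> \<and> finite (D \<inter> {\<gamma>..<\<beta>})}"

lemma block_pos_cong:
  assumes "D \<inter> {..<\<beta>} = D' \<inter> {..<\<beta>}" shows "block_pos D \<beta> = block_pos D' \<beta>"
proof -
  have "E \<inter> {\<gamma>..<\<beta>} = (E \<inter> {..<\<beta>}) \<inter> {\<gamma>..}" for E \<gamma> by auto
  then have "D \<inter> {\<gamma>..<\<beta>} = D' \<inter> {\<gamma>..<\<beta>}" for \<gamma> using assms by metis
  moreover have "\<gamma> \<in> D \<and> \<gamma> < \<beta> \<longleftrightarrow> \<gamma> \<in> D' \<and> \<gamma> < \<beta>" for \<gamma>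
    using assms by (metis Int_iff lessThan_iff)
  ultimately show ?thesis unfolding block_pos_def by (metis (no_types, lifting))
qed

text \<open>The set counted by \<open>block_pos\<close> is finite: only finitely many points of
  \<open>D\<close> lie between its least element and \<beta>, and the set is among them. It contains
  all points of \<open>D\<close> from \<delta> up to \<beta>.\<close>

lemma card_le_block_pos:
  assumes "finite (D \<inter> {\<delta>..<\<beta>})" shows "card (D \<inter> {\<delta>..<\<beta>}) \<le> block_pos D \<beta>"
  unfolding block_pos_def
proof (rule card_mono)
  show "D \<inter> {\<delta>..<\<beta>} \<subseteq> {\<gamma>\<in>D. \<gamma> < \<beta> \<and> finite (D \<inter> {\<gamma>..<\<beta>})}"
    by (auto intro!: finite_subset[OF _ assms])
  show "finite {\<gamma>\<in>D. \<gamma> < \<beta> \<and> finite (D \<inter> {\<gamma>..<\<beta>})}" (is "finite ?G")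
  proof (cases "?G = {}")
    case False
    then have L: "(LEAST \<gamma>. \<gamma> \<in> ?G) \<in> ?G" by (meson LeastI ex_in_conv)
    have "?G \<subseteq> D \<inter> {(LEAST \<gamma>. \<gamma> \<in> ?G)..<\<beta>}" using Least_le[of "\<lambda>\<gamma>. \<gamma> \<in> ?G"] by auto
    then show ?thesis using L finite_subset by blast
  next
    case True
    then show ?thesis by (simp only: finite.emptyI)
  qed
qed

text \<open>Hints that lead a walk up along \<open>x\<close>. Beyond the height of \<open>x\<close>
  the walk is left to \<open>seal\<close>.\<close>

definition node_hint :: "('k::wellorder) node \<Rightarrow> 'k \<Rightarrow> 'k node option"
  where "node_hint x \<gamma> = (if {..<\<gamma>} \<subseteq> dom x then Some (x |` {..<\<gamma>}) else None)"

text \<open>\<open>C\<close> is the club sequence and \<open>A\<close> the diamond sequence. The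
  coding \<open>c\<close> lets \<open>A\<close> guess sets of nodes; the labels \<open>h u i\<close>
  keep path entries with different \<open>u\<close> or different \<open>i\<close> apart.\<close>

locale souslin_construction = regular_uncountable K
  for K :: "'k::wellorder itself" +
  fixes \<chi> :: 'k and U :: "'k node set" and C :: "'k \<Rightarrow> 'k set" and A :: "'k \<Rightarrow> 'k set"
    and c :: "'k node \<Rightarrow> 'k" and h :: "'k node \<Rightarrow> nat \<Rightarrow> 'k"
  assumes chi_infinite: "infinite {..<\<chi>}"
    and chi_cardinal: "is_cardinal \<chi>"
    and U_closed: "downward_closed U"
    and U_small: "small K (level U \<alpha>)"
    and short_funs_small: "small K (short_funs lam \<chi>)"
    and C_club: "is_limit \<alpha> \<Longrightarrow> club_in (C \<alpha>) \<alpha>"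
    and C_coherent: "\<gamma> \<in> acc (C \<alpha>) \<Longrightarrow> C \<gamma> = C \<alpha> \<inter> {..<\<gamma>}"
    and C_hits: "(\<And>\<beta>. \<exists>\<gamma>\<in>B. \<beta> \<le> \<gamma>) \<Longrightarrow> stationary {\<alpha>\<in>E_ge \<chi>. \<forall>\<gamma><\<alpha>. \<exists>\<beta>\<in>C \<alpha>. \<gamma> < \<beta> \<and>
                         succ_omega (C \<alpha> - {..<\<beta>}) \<subseteq> B}"
    and A_guesses: "stationary {\<alpha>. Z \<inter> {..<\<alpha>} = A \<alpha>}"
    and c_inj: "inj_on c {x. is_node x}"
    and h_inj: "is_node u \<Longrightarrow> is_node v \<Longrightarrow> h u i = h v j \<Longrightarrow> u = v \<and> i = j"
begin

section \<open>The recursion for levels and path\<close>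

lemma ord_cases:
  obtains (zero) "\<And>\<beta>. \<not> \<beta> < \<alpha>" | (succ) p where "\<alpha> = osuc p" | (limit) "is_limit \<alpha>"
proof -
  have "\<exists>p. \<alpha> = osuc p" if "\<beta> < \<alpha>" "\<not> is_limit \<alpha>" for \<beta>
    using is_limit_or_last[OF that] lessThan_osuc lessThan_eq_iff by metis
  then show ?thesis using zero succ limit by blast
qed

lemma osuc_not_limit: "\<not> is_limit (osuc p)"
  unfolding is_limit_def using lessThan_osuc[of p] less_osuc[of p]
  by (metis atMost_iff lessThan_iff not_less)

lemma osuc_inj: "osuc p = osuc q \<Longrightarrow> p = q"
  using lessThan_osuc atMost_eq_iff by metis

text \<open>\<open>R\<close> is the history of the recursion, with the levels in the first component
  and the path in the second. The set guessed at \<beta> consists of the nodes of height below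
  \<beta> whose code lies in \<open>A \<beta>\<close>.\<close>

definition limit_node :: "('k \<Rightarrow> 'k node set \<times> ('k node \<Rightarrow> nat \<Rightarrow> 'k node)) \<Rightarrow> 'k \<Rightarrow> ('k \<Rightarrow> 'k node option) \<Rightarrow> 'k node"
  where "limit_node R \<alpha> H = glue (C \<alpha>)
    (walk (C \<alpha>) (\<lambda>\<beta>. fst (R \<beta>)) (\<lambda>\<beta>. {a. (\<exists>\<gamma><\<beta>. a \<in> fst (R \<gamma>)) \<and> c a \<in> A \<beta>}) H) \<alpha>"

text \<open>The hints stop after position \<open>i\<close>, so that the walk can seal the \<open>i\<close>-th entry; a given \<open>\<gamma>\<close>
  loses its hint for finitely many \<open>i\<close> only.\<close>

definition path_step :: "('k \<Rightarrow> 'k node set \<times> ('k node \<Rightarrow> nat \<Rightarrow> 'k node)) \<Rightarrow> 'k \<Rightarrow> 'k node \<Rightarrow> nat \<Rightarrow> 'k node"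
  where "path_step R \<alpha> u i =
    (if is_limit \<alpha> then limit_node R \<alpha>
        (\<lambda>\<gamma>. if block_pos (C \<alpha>) \<gamma> \<le> i then Some (snd (R \<gamma>) (u |` {..<\<gamma>}) i) else None)
     else if \<exists>\<beta>. \<beta> < \<alpha> then let p = (THE p. \<alpha> = osuc p) in (snd (R p) (u |` {..<p}) i)(p \<mapsto> h u i)
     else Map.empty)"

text \<open>At a limit, the first family lets every lower node extend to the level, the second
  contains the path entries, and the third provides completeness. At a successor, the labels below
  \<omega> or \<open>p\<close> make the tree prolific and the labels \<open>h u i\<close> make room
  for the path.\<close>

definition level_step :: "('k \<Rightarrow> 'k node set \<times> ('k node \<Rightarrow> nat \<Rightarrow> 'k node)) \<Rightarrow> 'k \<Rightarrow> 'k node set"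
  where "level_step R \<alpha> =
    (if is_limit \<alpha> then
       {limit_node R \<alpha> (node_hint x) |x \<gamma>. \<gamma> \<in> C \<alpha> \<and> x \<in> fst (R \<gamma>)} \<union>
       {path_step R \<alpha> u i |u i. u \<in> level U \<alpha>} \<union>
       (if cf_ge \<alpha> \<chi> then {} else {x. dom x = {..<\<alpha>} \<and> (\<forall>\<beta><\<alpha>. x |` {..<\<beta>} \<in> fst (R \<beta>))})
     else if \<exists>\<beta>. \<beta> < \<alpha> then let p = (THE p. \<alpha> = osuc p) in
       {x(p \<mapsto> \<xi>) |x \<xi>. x \<in> fst (R p) \<and> (\<xi> < omega_k \<or> \<xi> < p \<or> (\<exists>u\<in>level U \<alpha>. \<exists>i. \<xi> = h u i))}
     else {Map.empty})"

definition stage :: "'k \<Rightarrow> 'k node set \<times> ('k node \<Rightarrow> nat \<Rightarrow> 'k node)"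
  where "stage = wfrec {(\<beta>, \<gamma>). \<beta> < \<gamma>} (\<lambda>R \<alpha>. (level_step R \<alpha>, path_step R \<alpha>))"

lemma limit_node_cong:
  assumes "\<And>\<beta>. \<beta> < \<alpha> \<Longrightarrow> R \<beta> = R' \<beta>" "\<And>\<beta>. \<beta> < \<alpha> \<Longrightarrow> H \<beta> = H' \<beta>"
  shows "limit_node R \<alpha> H = limit_node R' \<alpha> H'"
  unfolding limit_node_def
proof (rule glue_walk_cong[OF refl], intro conjI)
  fix \<gamma> assume "\<gamma> < \<alpha>"
  moreover have "(\<exists>\<delta><\<gamma>. a \<in> fst (R \<delta>)) \<longleftrightarrow> (\<exists>\<delta><\<gamma>. a \<in> fst (R' \<delta>))" for a
    using assms(1) \<open>\<gamma> < \<alpha>\<close> by (metis less_trans)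
  ultimately show "fst (R \<gamma>) = fst (R' \<gamma>)" "H \<gamma> = H' \<gamma>"
    "{a. (\<exists>\<delta><\<gamma>. a \<in> fst (R \<delta>)) \<and> c a \<in> A \<gamma>} = {a. (\<exists>\<delta><\<gamma>. a \<in> fst (R' \<delta>)) \<and> c a \<in> A \<gamma>}"
    using assms by auto
qed

lemma the_pred: "(THE p. osuc q = osuc p) = q"
  using osuc_inj by blast

lemma path_step_cong:
  assumes "\<And>\<beta>. \<beta> < \<alpha> \<Longrightarrow> R \<beta> = R' \<beta>"
  shows "path_step R \<alpha> = path_step R' \<alpha>"
proof (rule ext, rule ext)
  fix u i show "path_step R \<alpha> u i = path_step R' \<alpha> u i"
  proof (cases \<alpha> rule: ord_cases)
    case limit
    have "limit_node R \<alpha> (\<lambda>\<gamma>. if block_pos (C \<alpha>) \<gamma> \<le> i then Some (snd (R \<gamma>) (u |` {..<\<gamma>}) i) else None) =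
        limit_node R' \<alpha> (\<lambda>\<gamma>. if block_pos (C \<alpha>) \<gamma> \<le> i then Some (snd (R' \<gamma>) (u |` {..<\<gamma>}) i) else None)"
      by (rule limit_node_cong[OF assms]) (simp_all add: assms)
    with limit show ?thesis by (simp add: path_step_def)
  next
    case (succ p)
    then show ?thesis
      using assms less_osuc[of p] by (simp add: path_step_def osuc_not_limit the_pred Let_def)
  qed (auto simp: path_step_def is_limit_def)
qed

lemma level_step_cong:
  assumes "\<And>\<beta>. \<beta> < \<alpha> \<Longrightarrow> R \<beta> = R' \<beta>"
  shows "level_step R \<alpha> = level_step R' \<alpha>"
proof (cases \<alpha> rule: ord_cases)
  case limit
  have R_eq: "R \<gamma> = R' \<gamma>" if "\<gamma> \<in> C \<alpha>" for \<gamma>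
    using assms C_club[OF limit] that unfolding club_in_def by (meson lessThan_iff subsetD)
  have "limit_node R \<alpha> H = limit_node R' \<alpha> H" for H
    by (rule limit_node_cong[OF assms]) auto
  moreover have "(\<exists>x \<gamma>. y = limit_node R' \<alpha> (node_hint x) \<and> \<gamma> \<in> C \<alpha> \<and> x \<in> fst (R \<gamma>))
      \<longleftrightarrow> (\<exists>x \<gamma>. y = limit_node R' \<alpha> (node_hint x) \<and> \<gamma> \<in> C \<alpha> \<and> x \<in> fst (R' \<gamma>))" for y
    using R_eq by (metis (no_types, lifting))
  ultimately show ?thesis
    using limit assms path_step_cong[OF assms] unfolding level_step_def by auto
next
  case (succ p)
  then show ?thesis
    using assms less_osuc[of p] by (simp add: level_step_def osuc_not_limit the_pred Let_def)
qed (auto simp: level_step_def is_limit_def)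

lemma stage_eq: "stage \<alpha> = (level_step stage \<alpha>, path_step stage \<alpha>)"
proof -
  have "adm_wf {(\<beta>, \<gamma>). \<beta> < \<gamma>} (\<lambda>R \<alpha>. (level_step R \<alpha>, path_step R \<alpha>))"
    unfolding adm_wf_def
  proof (intro allI impI)
    fix R R' :: "'k \<Rightarrow> 'k node set \<times> ('k node \<Rightarrow> nat \<Rightarrow> 'k node)" and \<alpha> :: 'k
    assume "\<forall>\<beta>. (\<beta>, \<alpha>) \<in> {(\<beta>, \<gamma>). \<beta> < \<gamma>} \<longrightarrow> R \<beta> = R' \<beta>"
    then have "\<And>\<beta>. \<beta> < \<alpha> \<Longrightarrow> R \<beta> = R' \<beta>" by simp
    then show "(level_step R \<alpha>, path_step R \<alpha>) = (level_step R' \<alpha>, path_step R' \<alpha>)"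
      using level_step_cong[of \<alpha> R R'] path_step_cong[of \<alpha> R R'] by simp
  qed
  from fun_cong[OF wfrec_fixpoint[OF wf this], of \<alpha>] show ?thesis
    unfolding stage_def by simp
qed

section \<open>The tree and the path read off from the recursion\<close>

definition L :: "'k \<Rightarrow> 'k node set"
  where "L \<alpha> = fst (stage \<alpha>)"

definition T :: "'k node set"
  where "T = (\<Union>\<alpha>. L \<alpha>)"

definition path :: "'k node \<Rightarrow> nat \<Rightarrow> 'k node"
  where "path u = snd (stage (height u)) u"

definition guess :: "'k \<Rightarrow> 'k node set"
  where "guess \<beta> = {a. (\<exists>\<gamma><\<beta>. a \<in> L \<gamma>) \<and> c a \<in> A \<beta>}"

definition lim :: "'k \<Rightarrow> ('k \<Rightarrow> 'k node option) \<Rightarrow> 'k node"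
  where "lim \<alpha> H = glue (C \<alpha>) (walk (C \<alpha>) L guess H) \<alpha>"

definition path_hint :: "'k set \<Rightarrow> 'k node \<Rightarrow> nat \<Rightarrow> 'k \<Rightarrow> 'k node option"
  where "path_hint D u i \<gamma> = (if block_pos D \<gamma> \<le> i then Some (path (u |` {..<\<gamma>}) i) else None)"

lemma limit_node_stage: "limit_node stage \<alpha> H = lim \<alpha> H"
  unfolding limit_node_def lim_def guess_def L_def by simp

lemma path_eq_step: "dom u = {..<\<alpha>} \<Longrightarrow> path u = path_step stage \<alpha> u"
  using stage_eq[of \<alpha>] by (simp add: path_def height_eq)

lemma snd_stage:
  assumes "dom u = {..<\<alpha>}" "\<gamma> \<le> \<alpha>"
  shows "snd (stage \<gamma>) (u |` {..<\<gamma>}) = path (u |` {..<\<gamma>})"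
  unfolding path_def using height_eq[OF dom_restrict_lessThan[OF assms]] by simp

lemma path_limit:
  assumes "is_limit \<alpha>" "dom u = {..<\<alpha>}"
  shows "path u i = lim \<alpha> (path_hint (C \<alpha>) u i)"
proof -
  have "path u i = limit_node stage \<alpha>
        (\<lambda>\<gamma>. if block_pos (C \<alpha>) \<gamma> \<le> i then Some (snd (stage \<gamma>) (u |` {..<\<gamma>}) i) else None)"
    using assms path_eq_step[OF assms(2)] by (simp add: path_step_def)
  also have "\<dots> = limit_node stage \<alpha> (path_hint (C \<alpha>) u i)"
    by (rule limit_node_cong) (simp_all add: path_hint_def snd_stage[OF assms(2)])
  finally show ?thesis by (simp add: limit_node_stage)
qed

lemma path_osuc: "dom u = {..<osuc p} \<Longrightarrow> path u i = (path (u |` {..<p}) i)(p \<mapsto> h u i)"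
  using path_eq_step[of u "osuc p"] snd_stage[of u "osuc p" p] less_osuc[of p]
  by (auto simp: path_step_def osuc_not_limit the_pred Let_def)

lemma path_zero: "(\<And>\<beta>. \<not> \<beta> < \<alpha>) \<Longrightarrow> dom u = {..<\<alpha>} \<Longrightarrow> path u i = Map.empty"
  using path_eq_step[of u \<alpha>] by (auto simp: path_step_def is_limit_def)

lemma dom_level: "u \<in> level U \<alpha> \<Longrightarrow> dom u = {..<\<alpha>}"
  by (simp add: level_def)

lemma L_limit:
  assumes "is_limit \<alpha>"
  shows "L \<alpha> = {lim \<alpha> (node_hint x) |x \<gamma>. \<gamma> \<in> C \<alpha> \<and> x \<in> L \<gamma>} \<union>
    {lim \<alpha> (path_hint (C \<alpha>) u i) |u i. u \<in> level U \<alpha>} \<union>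
    (if cf_ge \<alpha> \<chi> then {} else {x. dom x = {..<\<alpha>} \<and> (\<forall>\<beta><\<alpha>. x |` {..<\<beta>} \<in> L \<beta>)})"
proof -
  have "path_step stage \<alpha> u i = lim \<alpha> (path_hint (C \<alpha>) u i)" if "u \<in> level U \<alpha>" for u i
    using path_limit[OF assms dom_level[OF that]] path_eq_step[OF dom_level[OF that]] by simp
  then have "{path_step stage \<alpha> u i |u i. u \<in> level U \<alpha>} = {lim \<alpha> (path_hint (C \<alpha>) u i) |u i. u \<in> level U \<alpha>}"
    by (intro Collect_cong) metis
  then show ?thesis
    using assms stage_eq[of \<alpha>] unfolding L_def[of \<alpha>]
    by (simp add: level_step_def limit_node_stage L_def)
qed

lemma L_osuc: "L (osuc p) =
    {x(p \<mapsto> \<xi>) |x \<xi>. x \<in> L p \<and> (\<xi> < omega_k \<or> \<xi> < p \<or> (\<exists>u\<in>level U (osuc p). \<exists>i. \<xi> = h u i))}"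
  using stage_eq[of "osuc p"] less_osuc[of p]
  by (auto simp: L_def level_step_def osuc_not_limit the_pred Let_def)

lemma L_zero: "(\<And>\<beta>. \<not> \<beta> < \<alpha>) \<Longrightarrow> L \<alpha> = {Map.empty}"
  using stage_eq[of \<alpha>] by (auto simp: L_def level_step_def is_limit_def)

lemma level_U_restrict:
  assumes "u \<in> level U \<alpha>" "\<beta> \<le> \<alpha>"
  shows "u |` {..<\<beta>} \<in> level U \<beta>"
proof -
  have d: "dom (u |` {..<\<beta>}) = {..<\<beta>}" using dom_restrict_lessThan[OF dom_level[OF assms(1)] assms(2)] .
  moreover have "u |` {..<\<beta>} \<in> U"
    using U_closed assms d restrict_map_le unfolding downward_closed_def level_def is_node_def
    by blast
  ultimately show ?thesis by (simp add: level_def)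
qed

lemma path_in_L: "u \<in> level U \<alpha> \<Longrightarrow> path u i \<in> L \<alpha>"
proof (induction \<alpha> arbitrary: u rule: less_induct)
  case (less \<alpha>)
  show ?case
  proof (cases \<alpha> rule: ord_cases)
    case limit
    then show ?thesis
      using less.prems L_limit path_limit[OF limit dom_level[OF less.prems]] by blast
  next
    case (succ p)
    then have "path (u |` {..<p}) i \<in> L p"
      using less level_U_restrict[of u \<alpha> p] less_osuc[of p] by auto
    then show ?thesis
      using succ less.prems path_osuc[of u p i] dom_level[OF less.prems] unfolding succ L_osuc by blast
  next
    case zero
    then show ?thesis
      using L_zero path_zero dom_level[OF less.prems] by blast
  qed
qed

section \<open>Normality of the levels\<close>

definition level_inv :: "'k \<Rightarrow> bool"
  where "level_inv \<alpha> \<longleftrightarrow> (\<forall>x\<in>L \<alpha>. dom x = {..<\<alpha>}) \<and> (\<forall>x\<in>L \<alpha>. \<forall>\<beta>\<le>\<alpha>. x |` {..<\<beta>} \<in> L \<beta>) \<and>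
    (\<forall>\<beta>\<le>\<alpha>. \<forall>x\<in>L \<beta>. \<exists>y\<in>L \<alpha>. x \<subseteq>\<^sub>m y) \<and> L \<alpha> \<noteq> {}"

lemma level_invD:
  assumes "level_inv \<alpha>"
  shows "x \<in> L \<alpha> \<Longrightarrow> dom x = {..<\<alpha>}" "x \<in> L \<alpha> \<Longrightarrow> \<beta> \<le> \<alpha> \<Longrightarrow> x |` {..<\<beta>} \<in> L \<beta>"
    "\<beta> \<le> \<alpha> \<Longrightarrow> y \<in> L \<beta> \<Longrightarrow> \<exists>z\<in>L \<alpha>. y \<subseteq>\<^sub>m z" "L \<alpha> \<noteq> {}"
  using assms by (simp_all add: level_inv_def)

text \<open>Collects both kinds of hints behind the walks of a limit level, so that they can be
  treated together. The other nodes of the level are the branches added at small cofinality.\<close>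

definition admissible :: "'k \<Rightarrow> ('k \<Rightarrow> 'k node option) \<Rightarrow> bool"
  where "admissible \<alpha> H \<longleftrightarrow> (\<exists>\<delta>\<in>C \<alpha>. \<exists>x\<in>L \<delta>. H = node_hint x) \<or>
    (\<exists>u\<in>level U \<alpha>. \<exists>i. H = path_hint (C \<alpha>) u i)"

lemma L_limit_iff:
  assumes "is_limit \<alpha>"
  shows "x \<in> L \<alpha> \<longleftrightarrow> (\<exists>H. admissible \<alpha> H \<and> x = lim \<alpha> H) \<or>
    \<not> cf_ge \<alpha> \<chi> \<and> dom x = {..<\<alpha>} \<and> (\<forall>\<beta><\<alpha>. x |` {..<\<beta>} \<in> L \<beta>)"
  unfolding L_limit[OF assms] admissible_def by (cases "cf_ge \<alpha> \<chi>") (simp_all, blast+)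

lemma C_lessD: "is_limit \<alpha> \<Longrightarrow> \<gamma> \<in> C \<alpha> \<Longrightarrow> \<gamma> < \<alpha>"
  using C_club unfolding club_in_def by blast

lemma accD:
  assumes "\<gamma> \<in> acc (C \<alpha>)"
  shows "\<gamma> \<in> C \<alpha>" "C \<gamma> = C \<alpha> \<inter> {..<\<gamma>}" "is_limit \<gamma>"
  using assms acc_is_limit[OF assms] C_coherent[OF assms] by (auto simp only: acc_def)

text \<open>By coherence \<open>C \<alpha>\<close> and \<open>C \<gamma>\<close> coincide below
  \<gamma>, hence so do block positions and hints, and the walk is the one that defined the path
  entry at level \<gamma>. There is no exceptional \<open>i\<close> here.\<close>

lemma path_hint_at_acc:
  assumes "is_limit \<alpha>" "\<gamma> \<in> acc (C \<alpha>)" "u \<in> level U \<alpha>"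
  shows "glue (C \<alpha>) (walk (C \<alpha>) L guess (path_hint (C \<alpha>) u i)) \<gamma> = path (u |` {..<\<gamma>}) i"
proof -
  have "\<gamma> < \<alpha>" using C_lessD[OF assms(1)] accD(1)[OF assms(2)] by blast
  have C: "C \<alpha> \<inter> {..<\<gamma>} = C \<gamma> \<inter> {..<\<gamma>}" using accD(2)[OF assms(2)] by auto
  have "path_hint (C \<alpha>) u i \<beta> = path_hint (C \<gamma>) (u |` {..<\<gamma>}) i \<beta>" if "\<beta> < \<gamma>" for \<beta>
  proof -
    have "block_pos (C \<alpha>) \<beta> = block_pos (C \<gamma>) \<beta>"
      using C that by (intro block_pos_cong) force
    then show ?thesis
      using that by (simp add: path_hint_def Int_absorb1 less_imp_le)
  qed
  then have "glue (C \<alpha>) (walk (C \<alpha>) L guess (path_hint (C \<alpha>) u i)) \<gamma> = lim \<gamma> (path_hint (C \<gamma>) (u |` {..<\<gamma>}) i)"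
    unfolding lim_def by (intro glue_walk_cong[OF C]) auto
  then show ?thesis
    using path_limit[OF accD(3)[OF assms(2)]] dom_level[OF level_U_restrict[OF assms(3)]] \<open>\<gamma> < \<alpha>\<close>
    by simp
qed

text \<open>If \<delta> < \<gamma>, coherence puts \<delta> into \<open>C \<gamma>\<close>, and the
  same walk was used at level \<gamma>. Otherwise the walk has so far only climbed \<open>x\<close>,
  and the glued node is a restriction of \<open>x\<close>.\<close>

lemma node_hint_at_acc:
  assumes "is_limit \<alpha>" "\<gamma> \<in> acc (C \<alpha>)" "\<delta> \<in> C \<alpha>" "x \<in> L \<delta>" "level_inv \<delta>"
  shows "glue (C \<alpha>) (walk (C \<alpha>) L guess (node_hint x)) \<gamma> \<in> L \<gamma>"
proof (cases "\<delta> < \<gamma>")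
  case True
  then have "\<delta> \<in> C \<gamma>" using assms accD(2) by auto
  moreover have "glue (C \<alpha>) (walk (C \<alpha>) L guess (node_hint x)) \<gamma> = lim \<gamma> (node_hint x)"
    unfolding lim_def using accD(2)[OF assms(2)] by (intro glue_walk_cong) auto
  ultimately show ?thesis
    using L_limit[OF accD(3)[OF assms(2)]] assms(4) by blast
next
  case False
  have dx: "dom x = {..<\<delta>}" by (rule level_invD(1)[OF assms(5,4)])
  let ?w = "walk (C \<alpha>) L guess (node_hint x)"
  have w: "?w \<beta> = x |` {..<\<beta>}" if "\<beta> \<in> C \<alpha>" "\<beta> < \<gamma>" for \<beta>
    by (rule walk_follows_hints[OF _ that(1)]) (use dx False that in \<open>auto simp: node_hint_def\<close>)
  have "tower (C \<alpha>) ?w \<gamma>"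
    unfolding tower_def
  proof (intro conjI ballI impI)
    fix \<beta> assume "\<beta> \<in> C \<alpha>" "\<beta> < \<gamma>"
    then show "dom (?w \<beta>) = {..<\<beta>}" using w dom_restrict_lessThan[OF dx] False by auto
  next
    fix \<beta> \<epsilon> assume "\<beta> \<in> C \<alpha>" "\<epsilon> \<in> C \<alpha>" "\<beta> < \<epsilon> \<and> \<epsilon> < \<gamma>"
    then have "?w \<beta> = x |` {..<\<beta>}" "?w \<epsilon> = x |` {..<\<epsilon>}" "\<beta> < \<epsilon>"
      using w[of \<beta>] w[of \<epsilon>] by auto
    then show "?w \<beta> \<subseteq>\<^sub>m ?w \<epsilon>"
      by (auto simp: map_le_def restrict_map_def split: if_splits)
  qed
  moreover have "\<exists>\<beta>\<in>C \<alpha>. \<xi> < \<beta> \<and> \<beta> < \<gamma>" if "\<xi> < \<gamma>" for \<xi>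
    using assms(2) that unfolding acc_def by blast
  ultimately have "dom (glue (C \<alpha>) ?w \<gamma>) = {..<\<gamma>}"
    by (rule dom_glue)
  moreover have "glue (C \<alpha>) ?w \<gamma> \<subseteq>\<^sub>m x"
    by (rule glue_least) (simp add: w restrict_map_le)
  ultimately have "glue (C \<alpha>) ?w \<gamma> = x |` {..<\<gamma>}"
    using map_le_iff_restrict by metis
  then show ?thesis
    using level_invD(2)[OF assms(5,4)] False by simp
qed

lemma walk_system:
  assumes lim: "is_limit \<alpha>" and inv: "\<And>\<beta>. \<beta> < \<alpha> \<Longrightarrow> level_inv \<beta>" and H: "admissible \<alpha> H"
  shows "walk_system \<alpha> (C \<alpha>) L guess H"
proof
  show "club_in (C \<alpha>) \<alpha>" by (rule C_club[OF lim])
  show "dom x = {..<\<beta>}" if "\<beta> < \<alpha>" "x \<in> L \<beta>" for \<beta> x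
    by (rule level_invD(1)[OF inv]) fact+
  show "\<exists>y\<in>L \<gamma>. x \<subseteq>\<^sub>m y" if "\<beta> \<le> \<gamma>" "\<gamma> < \<alpha>" "x \<in> L \<beta>" for \<beta> \<gamma> x
    by (rule level_invD(3)[OF inv]) fact+
  show "L \<beta> \<noteq> {}" if "\<beta> < \<alpha>" for \<beta>
    by (rule level_invD(4)[OF inv]) fact
  fix \<gamma> y assume \<gamma>: "\<gamma> \<in> C \<alpha>" and y: "H \<gamma> = Some y"
  show "y \<in> L \<gamma>"
    using H unfolding admissible_def
  proof (elim disjE bexE exE)
    fix \<delta> x assume *: "\<delta> \<in> C \<alpha>" "x \<in> L \<delta>" "H = node_hint x"
    then have \<delta>: "level_inv \<delta>" using inv C_lessD[OF lim] by blast
    have x: "{..<\<gamma>} \<subseteq> dom x" "y = x |` {..<\<gamma>}"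
      using y *(3) by (auto simp: node_hint_def split: if_splits)
    then have "\<gamma> \<le> \<delta>" using level_invD(1)[OF \<delta> *(2)] by simp
    then show ?thesis using level_invD(2)[OF \<delta> *(2)] x(2) by simp
  next
    fix u i assume "u \<in> level U \<alpha>" "H = path_hint (C \<alpha>) u i"
    then show ?thesis
      using y path_in_L[OF level_U_restrict[of u \<alpha> \<gamma>]] C_lessD[OF lim \<gamma>]
      by (auto simp: path_hint_def split: if_splits)
  qed
next
  fix \<gamma> assume \<gamma>: "\<gamma> \<in> acc (C \<alpha>)"
  then have "\<gamma> < \<alpha>" using C_lessD[OF lim] accD by blast
  show "glue (C \<alpha>) (walk (C \<alpha>) L guess H) \<gamma> \<in> L \<gamma>"
    using H unfolding admissible_def
  proof (elim disjE bexE exE)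
    fix \<delta> x assume "\<delta> \<in> C \<alpha>" "x \<in> L \<delta>" "H = node_hint x"
    then show ?thesis
      using node_hint_at_acc[OF lim \<gamma>] inv C_lessD[OF lim] by blast
  next
    fix u i assume "u \<in> level U \<alpha>" "H = path_hint (C \<alpha>) u i"
    then show ?thesis
      using path_hint_at_acc[OF lim \<gamma>] path_in_L[OF level_U_restrict] \<open>\<gamma> < \<alpha>\<close>
      by (simp add: less_imp_le)
  qed
qed

text \<open>Normality below \<alpha> makes every admissible walk a \<open>walk_system\<close>, which
  controls the domain and the restrictions of its limit; the added branches satisfy both by
  definition.\<close>

lemma level_inv_limit:
  assumes lim: "is_limit \<alpha>" and inv: "\<And>\<beta>. \<beta> < \<alpha> \<Longrightarrow> level_inv \<beta>"
  shows "level_inv \<alpha>"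
proof -
  have cof: "\<exists>\<gamma>\<in>C \<alpha>. \<beta> < \<gamma>" if "\<beta> < \<alpha>" for \<beta>
    using C_club[OF lim] that unfolding club_in_def by blast
  have dom: "dom x = {..<\<alpha>}" and rest: "\<beta> < \<alpha> \<Longrightarrow> x |` {..<\<beta>} \<in> L \<beta>" if x: "x \<in> L \<alpha>" for x \<beta>
  proof -
    from x consider H where "admissible \<alpha> H" "x = lim \<alpha> H" |
      "dom x = {..<\<alpha>}" "\<And>\<beta>. \<beta> < \<alpha> \<Longrightarrow> x |` {..<\<beta>} \<in> L \<beta>"
      using L_limit_iff[OF lim] by blast
    then have "dom x = {..<\<alpha>} \<and> (\<beta> < \<alpha> \<longrightarrow> x |` {..<\<beta>} \<in> L \<beta>)"
    proof cases
      case (1 H)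
      then interpret walk_system \<alpha> "C \<alpha>" L guess H by (intro walk_system[OF lim inv])
      have "x |` {..<\<beta>} \<in> L \<beta>" if b: "\<beta> < \<alpha>"
      proof -
        obtain \<gamma> where \<gamma>: "\<gamma> \<in> C \<alpha>" "\<beta> < \<gamma>" using cof[OF b] by blast
        then have "x |` {..<\<gamma>} \<in> L \<gamma>"
          using limit_restrict walk_invariant 1 unfolding lim_def by metis
        then have "(x |` {..<\<gamma>}) |` {..<\<beta>} \<in> L \<beta>"
          by (rule level_invD(2)[OF inv[OF C_less[OF \<gamma>(1)]]]) (simp add: \<gamma> less_imp_le)
        then show ?thesis using \<gamma> by (simp add: Int_absorb1 less_imp_le)
      qed
      then show ?thesis using dom_limit 1 unfolding lim_def by blast
    qed auto
    then show "dom x = {..<\<alpha>}" "\<beta> < \<alpha> \<Longrightarrow> x |` {..<\<beta>} \<in> L \<beta>" by auto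
  qed
  have ext: "\<exists>y\<in>L \<alpha>. x \<subseteq>\<^sub>m y" if b: "\<beta> < \<alpha>" "x \<in> L \<beta>" for \<beta> x
  proof -
    \<comment> \<open>First extend \<open>x\<close> to a node \<open>z\<close> at a level in
      \<open>C \<alpha>\<close>. The walk that climbs \<open>z\<close> passes through
      \<open>z\<close>, so its limit lies above \<open>x\<close>.\<close>
    obtain \<gamma> where \<gamma>: "\<gamma> \<in> C \<alpha>" "\<beta> < \<gamma>" "\<gamma> < \<alpha>" using cof[OF b(1)] C_lessD[OF lim] by blast
    then obtain z where z: "z \<in> L \<gamma>" "x \<subseteq>\<^sub>m z"
      using level_invD(3)[OF inv[OF \<gamma>(3)], of \<beta> x] b \<gamma>(2) by (auto simp: less_imp_le)
    have adm: "admissible \<alpha> (node_hint z)" unfolding admissible_def using \<gamma> z by blast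
    interpret walk_system \<alpha> "C \<alpha>" L guess "node_hint z" by (rule walk_system[OF lim inv adm])
    have "dom z = {..<\<gamma>}" using dom_L[OF \<gamma>(3) z(1)] .
    then have "walk (C \<alpha>) L guess (node_hint z) \<gamma> = z |` {..<\<gamma>}"
      using \<gamma> by (intro walk_follows_hints) (auto simp: node_hint_def)
    then have "z \<subseteq>\<^sub>m lim \<alpha> (node_hint z)"
      using walk_le_limit[OF \<gamma>(1)] restrict_lessThan_self[OF \<open>dom z = {..<\<gamma>}\<close>] unfolding lim_def by simp
    moreover have "lim \<alpha> (node_hint z) \<in> L \<alpha>" using L_limit_iff[OF lim] adm by blast
    ultimately show ?thesis using z map_le_trans by blast
  qed
  obtain \<beta> where "\<beta> < \<alpha>" using lim unfolding is_limit_def by blast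
  then have "L \<alpha> \<noteq> {}" using ext level_invD(4)[OF inv] by blast
  moreover have "\<forall>x\<in>L \<alpha>. \<forall>\<beta>\<le>\<alpha>. x |` {..<\<beta>} \<in> L \<beta>"
    using rest dom restrict_lessThan_self by (metis order.order_iff_strict)
  moreover have "\<forall>\<beta>\<le>\<alpha>. \<forall>x\<in>L \<beta>. \<exists>y\<in>L \<alpha>. x \<subseteq>\<^sub>m y"
    using ext map_le_refl by (metis order.order_iff_strict)
  ultimately show ?thesis
    using dom unfolding level_inv_def by blast
qed

lemma bot_less_omega: "\<exists>a::'k. a < omega_k"
proof -
  have "infinite {..<(omega_k::'k)}"
    unfolding omega_k_def by (rule LeastI[of "\<lambda>a. infinite {..<a}", OF chi_infinite])
  then have "{..<(omega_k::'k)} \<noteq> {}" by (metis finite.emptyI)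
  then show ?thesis by blast
qed

lemma level_inv_osuc:
  assumes inv: "\<And>\<beta>. \<beta> \<le> p \<Longrightarrow> level_inv \<beta>"
  shows "level_inv (osuc p)"
proof -
  have le: "\<beta> < osuc p \<longleftrightarrow> \<beta> \<le> p" for \<beta> using lessThan_osuc[of p] by (metis atMost_iff lessThan_iff)
  have shape: "dom y = {..<osuc p} \<and> y |` {..<p} \<in> L p" if y: "y \<in> L (osuc p)" for y
  proof -
    obtain x \<xi> where x: "y = x(p \<mapsto> \<xi>)" "x \<in> L p" using y unfolding L_osuc by blast
    then have d: "dom x = {..<p}" using level_invD(1)[OF inv] by blast
    then have "y |` {..<p} = x" unfolding x(1) by (simp add: restrict_lessThan_self)
    moreover have "dom y = {..<osuc p}" unfolding x(1) lessThan_osuc using d by auto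
    ultimately show ?thesis using x by simp
  qed
  have rest: "y |` {..<\<beta>} \<in> L \<beta>" if "y \<in> L (osuc p)" "\<beta> \<le> p" for y \<beta>
  proof -
    have "(y |` {..<p}) |` {..<\<beta>} \<in> L \<beta>"
      using shape[OF that(1)] level_invD(2)[OF inv] that(2) by blast
    then show ?thesis using that by (simp add: Int_absorb1)
  qed
  have ext: "\<exists>y\<in>L (osuc p). x \<subseteq>\<^sub>m y" if b: "\<beta> \<le> p" "x \<in> L \<beta>" for \<beta> x
  proof -
    obtain z where z: "z \<in> L p" "x \<subseteq>\<^sub>m z" using level_invD(3)[OF inv[OF order_refl] b] by blast
    obtain \<xi> :: 'k where "\<xi> < omega_k" using bot_less_omega by blast
    then have "z(p \<mapsto> \<xi>) \<in> L (osuc p)" using z unfolding L_osuc by blast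
    moreover have "z \<subseteq>\<^sub>m z(p \<mapsto> \<xi>)"
      using level_invD(1)[OF inv z(1)] by (auto simp: map_le_def)
    ultimately show ?thesis using z map_le_trans by blast
  qed
  have "L (osuc p) \<noteq> {}" using ext[of p] level_invD(4)[OF inv] by blast
  moreover have "\<forall>x\<in>L (osuc p). \<forall>\<beta>\<le>osuc p. x |` {..<\<beta>} \<in> L \<beta>"
    using rest shape restrict_lessThan_self le by (metis order.order_iff_strict)
  moreover have "\<forall>\<beta>\<le>osuc p. \<forall>x\<in>L \<beta>. \<exists>y\<in>L (osuc p). x \<subseteq>\<^sub>m y"
    using ext map_le_refl le by (metis order.order_iff_strict)
  ultimately show ?thesis using shape unfolding level_inv_def by blast
qed

lemma level_inv: "level_inv \<alpha>"
proof (induction \<alpha> rule: less_induct)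
  case (less \<alpha>)
  show ?case
  proof (cases \<alpha> rule: ord_cases)
    case zero
    then have "\<beta> \<le> \<alpha> \<longleftrightarrow> \<beta> = \<alpha>" for \<beta> by (metis order.order_iff_strict)
    moreover have "{..<\<alpha>} = {}" using zero by auto
    ultimately show ?thesis
      unfolding level_inv_def by (simp add: L_zero[OF zero] map_le_refl)
  next
    case (succ p)
    have "\<beta> < \<alpha>" if "\<beta> \<le> p" for \<beta> using that less_osuc[of p] succ by simp
    then show ?thesis using level_inv_osuc[of p] less.IH succ by blast
  next
    case limit
    then show ?thesis using level_inv_limit less.IH by blast
  qed
qed

lemma dom_L: "x \<in> L \<alpha> \<Longrightarrow> dom x = {..<\<alpha>}"
  by (rule level_invD[OF level_inv])

lemma L_restrict: "x \<in> L \<alpha> \<Longrightarrow> \<beta> \<le> \<alpha> \<Longrightarrow> x |` {..<\<beta>} \<in> L \<beta>"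
  by (rule level_invD[OF level_inv])

lemma L_nonempty: "L \<alpha> \<noteq> {}"
  by (rule level_invD[OF level_inv])

lemma level_T: "level T \<alpha> = L \<alpha>"
  unfolding level_def T_def using dom_L by (auto; metis lessThan_eq_iff)

end

section \<open>Size of the levels\<close>

context regular_uncountable
begin

text \<open>\<open>r\<close> is the collapse of \<open>X\<close>: each element goes to the least
  ordinal not taken by earlier ones, so the image is an initial segment \<mu>. As \<chi> does not
  inject into \<open>X\<close>, the image cannot contain all of \<chi>.\<close>

lemma order_type_below:
  fixes X :: "'k set"
  assumes X: "small K X" and "\<not> {..<\<chi>} \<lesssim> X"
  obtains r \<mu> where "\<mu> < \<chi>" "bij_betw r X {..<(\<mu>::'k)}"
proof -
  define r :: "'k \<Rightarrow> 'k" where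
    "r = wfrec {(\<beta>, \<gamma>). \<beta> < \<gamma>} (\<lambda>r x. LEAST y. y \<notin> r ` (X \<inter> {..<x}))"
  have "adm_wf {(\<beta>, \<gamma>). \<beta> < \<gamma>} (\<lambda>r x. LEAST y::'k. y \<notin> r ` (X \<inter> {..<x}))"
    unfolding adm_wf_def
  proof (intro allI impI)
    fix f g :: "'k \<Rightarrow> 'k" and x
    assume "\<forall>z. (z, x) \<in> {(\<beta>, \<gamma>). \<beta> < \<gamma>} \<longrightarrow> f z = g z"
    then have "f ` (X \<inter> {..<x}) = g ` (X \<inter> {..<x})" by (intro image_cong) auto
    then show "(LEAST y. y \<notin> f ` (X \<inter> {..<x})) = (LEAST y. y \<notin> g ` (X \<inter> {..<x}))" by simp
  qed
  from fun_cong[OF wfrec_fixpoint[OF wf this]]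
  have r: "r x = (LEAST y. y \<notin> r ` (X \<inter> {..<x}))" for x unfolding r_def .
  have below: "y \<in> r ` X" if "y < r x" for x y
  proof -
    have "\<not> y \<notin> r ` (X \<inter> {..<x})"
      by (rule not_less_Least) (simp add: r[symmetric] that)
    then show ?thesis by (metis Int_iff image_iff)
  qed
  have new: "r x \<notin> r ` (X \<inter> {..<x})" for x
  proof -
    \<comment> \<open>Smallness of \<open>X\<close> bounds the values taken so far, so that a fresh
      one exists.\<close>
    obtain a where "r ` (X \<inter> {..<x}) \<subseteq> {..<a}"
      using small_bounded[OF small_image[OF small_subset[OF Int_lower1 X]]] .
    then have "a \<notin> r ` (X \<inter> {..<x})" by auto
    from LeastI[of "\<lambda>y. y \<notin> r ` (X \<inter> {..<x})", OF this] show ?thesis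
      unfolding r[of x] .
  qed
  have "\<not> {..<\<chi>} \<subseteq> r ` X"
    using assms(2) subset_image_lepoll by blast
  then obtain y where y: "y < \<chi>" "y \<notin> r ` X" by auto
  define \<mu> where "\<mu> = (LEAST y. y \<notin> r ` X)"
  have \<mu>: "\<mu> \<notin> r ` X" unfolding \<mu>_def by (rule LeastI) (rule y)
  have "\<mu> \<le> y" unfolding \<mu>_def by (rule Least_le) (rule y)
  then have "\<mu> < \<chi>" using y by simp
  moreover have "r ` X = {..<\<mu>}"
  proof
    show "r ` X \<subseteq> {..<\<mu>}"
    proof
      fix z assume z: "z \<in> r ` X"
      then have "\<not> \<mu> < z" using below \<mu> by auto
      moreover have "z \<noteq> \<mu>" using z \<mu> by auto
      ultimately show "z \<in> {..<\<mu>}" by auto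
    qed
    show "{..<\<mu>} \<subseteq> r ` X" unfolding \<mu>_def using not_less_Least by blast
  qed
  moreover have "inj_on r X"
  proof (rule inj_onI)
    fix x x' assume "x \<in> X" "x' \<in> X" "r x = r x'"
    then show "x = x'"
      using new[of x] new[of x'] by (metis IntI imageI lessThan_iff linorder_neqE)
  qed
  ultimately show ?thesis using that unfolding bij_betw_def by blast
qed

text \<open>The classical argument that diamond yields \<open>\<kappa>\<^bsup><\<kappa>\<^esup> = \<kappa>\<close>: every bounded subset of \<open>\<kappa>\<close>
  occurs in the diamond sequence, and nodes are coded by bounded sets.\<close>

lemma ex_node_coding:
  fixes A :: "'k \<Rightarrow> 'k set"
  assumes "\<And>Z. stationary {\<alpha>. Z \<inter> {..<\<alpha>} = A \<alpha>}"
  shows "\<exists>c :: 'k node \<Rightarrow> 'k. inj_on c {x. is_node x}"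
proof -
  obtain p :: "'k \<times> 'k \<Rightarrow> 'k" where p: "inj p" using ex_pairing by blast
  define code where "code x = p ` {(\<xi>, \<eta>). x \<xi> = Some \<eta>}" for x :: "'k node"
  have "\<exists>\<alpha>. A \<alpha> = code x" if x: "is_node x" for x
  proof -
    obtain a where a: "dom x = {..<a}" using x unfolding is_node_def by blast
    have "{(\<xi>, \<eta>). x \<xi> = Some \<eta>} \<subseteq> (\<lambda>\<xi>. (\<xi>, the (x \<xi>))) ` dom x" by force
    then have "small K {(\<xi>, \<eta>). x \<xi> = Some \<eta>}"
      unfolding a using small_image[OF lessThan_lesspoll] by (rule small_subset)
    then obtain b where b: "code x \<subseteq> {..<b}"
      unfolding code_def using small_bounded[OF small_image] by blast
    \<comment> \<open>Diamond is applied beyond the bound \<open>b\<close>, where the trace of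
      \<open>code x\<close> is all of \<open>code x\<close>.\<close>
    obtain \<alpha> where "code x \<inter> {..<\<alpha>} = A \<alpha>" "b < \<alpha>"
      using assms[of "code x"] club_closed_under[of b id] unfolding stationary_def by blast
    moreover have "code x \<inter> {..<\<alpha>} = code x" using b \<open>b < \<alpha>\<close> by fastforce
    ultimately show ?thesis by metis
  qed
  then obtain c where c: "\<And>x. is_node x \<Longrightarrow> A (c x) = code x" by metis
  have "inj_on c {x. is_node x}"
  proof (rule inj_onI)
    fix x y :: "'k node" assume "x \<in> {x. is_node x}" "y \<in> {x. is_node x}" "c x = c y"
    then have "code x = code y" using c by (metis mem_Collect_eq)
    then have "{(\<xi>, \<eta>). x \<xi> = Some \<eta>} = {(\<xi>, \<eta>). y \<xi> = Some \<eta>}"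
      unfolding code_def by (rule iffD1[OF inj_image_eq_iff[OF p]])
    then have "x \<xi> = Some \<eta> \<longleftrightarrow> y \<xi> = Some \<eta>" for \<xi> \<eta>
      by (simp add: set_eq_iff)
    then show "x = y" by (intro ext) (metis option.exhaust)
  qed
  then show ?thesis by blast
qed

end

section \<open>Counting the nodes of a level\<close>

context souslin_construction
begin

text \<open>A branch is determined by its restrictions to a cofinal set \<open>X\<close> enumerated
  by some \<mu> < \<chi>. Coding the nodes below level \<alpha> by ordinals below some
  \<open>lam\<close> turns it into a function from \<mu> to \<open>lam\<close>; here the hypothesis
  on \<lambda> to the power <\<chi> enters.\<close>

lemma branches_small:
  assumes lim: "is_limit \<alpha>" and cf: "\<not> cf_ge \<alpha> \<chi>" and small: "small K (\<Union>\<beta><\<alpha>. L \<beta>)"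
  shows "small K {x. dom x = {..<\<alpha>} \<and> (\<forall>\<beta><\<alpha>. x |` {..<\<beta>} \<in> L \<beta>)}" (is "small K ?B")
proof -
  obtain X where X: "X \<subseteq> {..<\<alpha>}" "\<And>\<beta>. \<beta> < \<alpha> \<Longrightarrow> \<exists>\<gamma>\<in>X. \<beta> \<le> \<gamma>" "\<not> {..<\<chi>} \<lesssim> X"
    using cf unfolding cf_ge_def by blast
  obtain r \<mu> where \<mu>: "\<mu> < \<chi>" "bij_betw r X {..<\<mu>}"
    using order_type_below[OF small_subset[OF X(1) lessThan_lesspoll] X(3)] .
  obtain lam :: 'k and e where e: "inj_on e (\<Union>\<beta><\<alpha>. L \<beta>)" "e ` (\<Union>\<beta><\<alpha>. L \<beta>) \<subseteq> {..<lam}"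
    using small unfolding small_iff_lepoll_lessThan lepoll_def by blast
  define s where "s = inv_into X r"
  have s: "s (r \<gamma>) = \<gamma>" "r \<gamma> < \<mu>" if "\<gamma> \<in> X" for \<gamma>
    using \<mu>(2) that unfolding s_def bij_betw_def by auto
  have sX: "s \<xi> \<in> X" if "\<xi> < \<mu>" for \<xi>
    using \<mu>(2) that unfolding s_def bij_betw_def by (metis inv_into_into lessThan_iff)
  define code where "code x = (\<lambda>\<xi>. if \<xi> < \<mu> then Some (e (x |` {..<s \<xi>})) else None)" for x :: "'k node"
  have rest: "x |` {..<\<gamma>} \<in> (\<Union>\<beta><\<alpha>. L \<beta>)" if "x \<in> ?B" "\<gamma> \<in> X" for x \<gamma>
    using that X(1) by auto
  have "inj_on code ?B"
  proof (rule inj_onI)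
    fix x y assume x: "x \<in> ?B" and y: "y \<in> ?B" and eq: "code x = code y"
    have *: "x |` {..<\<gamma>} = y |` {..<\<gamma>}" if "\<gamma> \<in> X" for \<gamma>
    proof -
      have "e (x |` {..<\<gamma>}) = e (y |` {..<\<gamma>})"
        using fun_cong[OF eq, of "r \<gamma>"] s[OF that] by (simp add: code_def)
      then show ?thesis using inj_onD[OF e(1)] rest[OF x that] rest[OF y that] by blast
    qed
    show "x = y"
    proof
      fix \<xi>
      show "x \<xi> = y \<xi>"
      proof (cases "\<xi> < \<alpha>")
        case True
        \<comment> \<open>Cofinality of \<open>X\<close> is stated with a weak inequality, so \<xi>
          is first raised to \<xi>' to get a point of \<open>X\<close> strictly above \<xi>.\<close>
        then obtain \<xi>' where "\<xi> < \<xi>'" "\<xi>' < \<alpha>" using lim unfolding is_limit_def by blast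
        then obtain \<gamma> where "\<gamma> \<in> X" "\<xi> < \<gamma>" using X(2) by fastforce
        then show ?thesis using fun_cong[OF *, of \<gamma> \<xi>] by simp
      next
        case False
        then have "\<xi> \<notin> dom x" "\<xi> \<notin> dom y" using x y by auto
        then show ?thesis by (simp add: domIff)
      qed
    qed
  qed
  moreover have "code ` ?B \<subseteq> short_funs lam \<chi>"
  proof
    fix g assume "g \<in> code ` ?B"
    then obtain x where x: "x \<in> ?B" "g = code x" by blast
    have "e (x |` {..<s \<xi>}) < lam" if "\<xi> < \<mu>" for \<xi>
      using e(2) rest[OF x(1) sX[OF that]] by blast
    then have "dom g = {..<\<mu>}" "ran g \<subseteq> {..<lam}"
      unfolding x(2) code_def by (auto simp: ran_def split: if_splits)
    then show "g \<in> short_funs lam \<chi>" unfolding short_funs_def using \<mu>(1) by blast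
  qed
  ultimately have "?B \<lesssim> short_funs lam \<chi>" unfolding lepoll_def by blast
  then show ?thesis by (rule small_lepoll[OF _ short_funs_small])
qed

lemma L_small: "small K (L \<alpha>)"
proof (induction \<alpha> rule: less_induct)
  case (less \<alpha>)
  have below: "small K (\<Union>\<beta><\<alpha>. L \<beta>)"
    by (rule small_UN[OF lessThan_lesspoll]) (simp add: less)
  show ?case
  proof (cases \<alpha> rule: ord_cases)
    case zero
    then show ?thesis by (simp add: L_zero small_countable)
  next
    case (succ p)
    let ?I = "({..<omega_k} \<union> {..<p}) \<union> (\<lambda>(u, i). h u i) ` (level U \<alpha> \<times> (UNIV :: nat set))"
    have "small K (level U \<alpha> \<times> (UNIV :: nat set))"
      by (rule small_Times[OF U_small small_countable]) simp
    then have "small K ?I" by (intro small_Un lessThan_lesspoll small_image)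
    moreover have "small K (L p)" using less less_osuc[of p] succ by simp
    ultimately have "small K ((\<lambda>(x, \<xi>). x(p \<mapsto> \<xi>)) ` (L p \<times> ?I))"
      by (intro small_image small_Times)
    moreover have "L \<alpha> \<subseteq> (\<lambda>(x, \<xi>). x(p \<mapsto> \<xi>)) ` (L p \<times> ?I)"
    proof
      fix y assume "y \<in> L \<alpha>"
      then obtain x \<xi> where "y = x(p \<mapsto> \<xi>)" "x \<in> L p" "\<xi> \<in> ?I"
        unfolding succ L_osuc by force
      then show "y \<in> (\<lambda>(x, \<xi>). x(p \<mapsto> \<xi>)) ` (L p \<times> ?I)" by force
    qed
    ultimately show ?thesis using small_subset by fast
  next
    case limit
    have "small K ((\<lambda>x. lim \<alpha> (node_hint x)) ` (\<Union>\<beta><\<alpha>. L \<beta>))"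
      by (rule small_image[OF below])
    moreover have "{lim \<alpha> (node_hint x) |x \<gamma>. \<gamma> \<in> C \<alpha> \<and> x \<in> L \<gamma>} \<subseteq> (\<lambda>x. lim \<alpha> (node_hint x)) ` (\<Union>\<beta><\<alpha>. L \<beta>)"
      using C_lessD[OF limit] by auto
    ultimately have 1: "small K {lim \<alpha> (node_hint x) |x \<gamma>. \<gamma> \<in> C \<alpha> \<and> x \<in> L \<gamma>}"
      by (rule small_subset[rotated])
    have "small K ((\<lambda>(u, i). lim \<alpha> (path_hint (C \<alpha>) u i)) ` (level U \<alpha> \<times> (UNIV :: nat set)))"
      by (intro small_image small_Times[OF U_small small_countable]) simp
    moreover have "{lim \<alpha> (path_hint (C \<alpha>) u i) |u i. u \<in> level U \<alpha>} \<subseteq>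
        (\<lambda>(u, i). lim \<alpha> (path_hint (C \<alpha>) u i)) ` (level U \<alpha> \<times> (UNIV :: nat set))"
      by force
    ultimately have 2: "small K {lim \<alpha> (path_hint (C \<alpha>) u i) |u i. u \<in> level U \<alpha>}"
      by (rule small_subset[rotated])
    have 3: "small K (if cf_ge \<alpha> \<chi> then {} else {x. dom x = {..<\<alpha>} \<and> (\<forall>\<beta><\<alpha>. x |` {..<\<beta>} \<in> L \<beta>)})"
      using branches_small[OF limit _ below] by (simp add: small_countable)
    show ?thesis
      unfolding L_limit[OF limit] by (intro small_Un 1 2 3)
  qed
qed

subsection \<open>The ascent path\<close>

lemma walk_system_at: "is_limit \<alpha> \<Longrightarrow> admissible \<alpha> H \<Longrightarrow> walk_system \<alpha> (C \<alpha>) L guess H"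
  by (rule walk_system[OF _ level_inv])

lemma map_le_same_dom: "x \<subseteq>\<^sub>m y \<Longrightarrow> dom x = dom y \<Longrightarrow> x = y"
  by (rule map_le_antisym) (auto simp: map_le_def)

text \<open>Induction along \<open>C \<alpha>\<close>. Passing from one point to the next loses
  finitely many \<open>i\<close>. At an accumulation point \<open>path_hint_at_acc\<close> holds for
  all \<open>i\<close>, so the exceptions do not pile up.\<close>

lemma walk_eq_path:
  assumes lim: "is_limit \<alpha>" and u: "u \<in> level U \<alpha>"
    and incr: "\<And>\<beta> \<gamma>. \<beta> < \<gamma> \<Longrightarrow> \<gamma> < \<alpha> \<Longrightarrow>
      \<forall>\<^sub>F i in cofinite. path (u |` {..<\<beta>}) i \<subseteq>\<^sub>m path (u |` {..<\<gamma>}) i"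
    and "\<beta> \<in> C \<alpha>"
  shows "\<forall>\<^sub>F i in cofinite. walk (C \<alpha>) L guess (path_hint (C \<alpha>) u i) \<beta> = path (u |` {..<\<beta>}) i"
  using \<open>\<beta> \<in> C \<alpha>\<close>
proof (induction \<beta> rule: less_induct)
  case (less \<beta>)
  let ?H = "path_hint (C \<alpha>) u"
  have adm: "admissible \<alpha> (?H i)" for i unfolding admissible_def using u by blast
  note ws = walk_system_at[OF lim adm]
  have "\<beta> < \<alpha>" using C_lessD[OF lim less.prems] .
  have follow: "walk (C \<alpha>) L guess (?H i) \<beta> = path (u |` {..<\<beta>}) i"
    if "glue (C \<alpha>) (walk (C \<alpha>) L guess (?H i)) \<beta> \<subseteq>\<^sub>m path (u |` {..<\<beta>}) i" "block_pos (C \<alpha>) \<beta> \<le> i" for i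
    using that by (simp add: walk_eq[of "C \<alpha>" L guess "?H i" \<beta>] path_hint_def pick_Some)
  consider "\<beta> \<in> acc (C \<alpha>)" | "\<And>\<delta>. \<delta> \<in> C \<alpha> \<Longrightarrow> \<not> \<delta> < \<beta>" |
    \<delta> where "\<delta> \<in> C \<alpha>" "\<delta> < \<beta>" "\<And>\<epsilon>. \<epsilon> \<in> C \<alpha> \<Longrightarrow> \<epsilon> < \<beta> \<Longrightarrow> \<epsilon> \<le> \<delta>"
    using walk_system.last_before[OF ws less.prems] by metis
  then show ?case
  proof cases
    case 1
    have "walk (C \<alpha>) L guess (?H i) \<beta> = path (u |` {..<\<beta>}) i" for i
    proof -
      have w: "walk (C \<alpha>) L guess (?H i) \<beta> \<in> L \<beta>"
        "glue (C \<alpha>) (walk (C \<alpha>) L guess (?H i)) \<beta> \<subseteq>\<^sub>m walk (C \<alpha>) L guess (?H i) \<beta>"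
        using walk_system.walk_invariant[OF ws less.prems] by blast+
      then have "path (u |` {..<\<beta>}) i \<subseteq>\<^sub>m walk (C \<alpha>) L guess (?H i) \<beta>"
        using path_hint_at_acc[OF lim 1 u] by simp
      moreover have "path (u |` {..<\<beta>}) i \<in> L \<beta>"
        using path_in_L level_U_restrict[OF u] \<open>\<beta> < \<alpha>\<close> by (simp add: less_imp_le)
      ultimately show ?thesis using map_le_same_dom dom_L w(1) by metis
    qed
    then show ?thesis by simp
  next
    case 2
    \<comment> \<open>The first point of the club has position 0, so every \<open>i\<close> receives
      its hint.\<close>
    then have "{\<gamma>\<in>C \<alpha>. \<gamma> < \<beta> \<and> finite (C \<alpha> \<inter> {\<gamma>..<\<beta>})} = {}" by blast
    then have "block_pos (C \<alpha>) \<beta> = 0" unfolding block_pos_def by (simp only: card.empty)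
    then have "walk (C \<alpha>) L guess (?H i) \<beta> = path (u |` {..<\<beta>}) i" for i
      using 2 by (intro follow glue_least) auto
    then show ?thesis by simp
  next
    case (3 \<delta>)
    have "\<forall>\<^sub>F i in cofinite. walk (C \<alpha>) L guess (?H i) \<delta> = path (u |` {..<\<delta>}) i"
      by (rule less.IH) (use 3 in auto)
    moreover have "\<forall>\<^sub>F i in cofinite. path (u |` {..<\<delta>}) i \<subseteq>\<^sub>m path (u |` {..<\<beta>}) i"
      by (rule incr[OF 3(2) \<open>\<beta> < \<alpha>\<close>])
    \<comment> \<open>The position of \<beta> is a fixed natural number, so the hint at \<beta> is
      withheld for finitely many \<open>i\<close> only.\<close>
    moreover have "\<forall>\<^sub>F i in cofinite. block_pos (C \<alpha>) \<beta> \<le> i"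
      by (simp add: eventually_cofinite not_le)
    ultimately show ?thesis
    proof eventually_elim
      case (elim i)
      have "tower (C \<alpha>) (walk (C \<alpha>) L guess (?H i)) \<beta>"
        using walk_system.walk_invariant[OF ws less.prems] by blast
      then have "glue (C \<alpha>) (walk (C \<alpha>) L guess (?H i)) \<beta> = walk (C \<alpha>) L guess (?H i) \<delta>"
        by (rule walk_system.glue_last[OF ws _ 3])
      with elim show ?case by (intro follow) simp_all
    qed
  qed
qed

text \<open>At a limit, a point \<gamma> of \<open>C \<alpha>\<close> above \<beta> is interposed.
  Almost every walk passes through the path entry at \<gamma>, which by induction lies above the
  entry at \<beta> for almost all \<open>i\<close>.\<close>

lemma path_increasing:
  assumes "u \<in> level U \<alpha>" "\<beta> \<le> \<alpha>"
  shows "\<forall>\<^sub>F i in cofinite. path (u |` {..<\<beta>}) i \<subseteq>\<^sub>m path u i"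
  using assms
proof (induction \<alpha> arbitrary: u \<beta> rule: less_induct)
  case (less \<alpha>)
  have du: "dom u = {..<\<alpha>}" by (rule dom_level[OF less.prems(1)])
  show ?case
  proof (cases "\<beta> = \<alpha>")
    case True
    then show ?thesis by (simp add: restrict_lessThan_self[OF du] map_le_refl)
  next
    case False
    then have "\<beta> < \<alpha>" using less.prems by simp
    have IH: "\<forall>\<^sub>F i in cofinite. path (u |` {..<\<delta>}) i \<subseteq>\<^sub>m path (u |` {..<\<gamma>}) i"
      if "\<delta> \<le> \<gamma>" "\<gamma> < \<alpha>" for \<delta> \<gamma>
      using less.IH[OF that(2) level_U_restrict[OF less.prems(1)] that(1)] that
      by (simp add: Int_absorb1 less_imp_le)
    show ?thesis
    proof (cases \<alpha> rule: ord_cases)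
      case zero
      then show ?thesis using \<open>\<beta> < \<alpha>\<close> by blast
    next
      case (succ p)
      have "\<beta> \<le> p" using \<open>\<beta> < \<alpha>\<close> osuc_le[of p \<beta>] succ by (metis not_le)
      then have "\<forall>\<^sub>F i in cofinite. path (u |` {..<\<beta>}) i \<subseteq>\<^sub>m path (u |` {..<p}) i"
        using IH less_osuc[of p] succ by blast
      moreover have "path (u |` {..<p}) i \<subseteq>\<^sub>m path u i" for i
      proof -
        have "path (u |` {..<p}) i \<in> L p"
          using path_in_L[OF level_U_restrict[OF less.prems(1)]] less_osuc[of p] succ by simp
        then have "dom (path (u |` {..<p}) i) = {..<p}" by (rule dom_L)
        then show ?thesis
          using path_osuc[of u p i] du succ by (auto simp: map_le_def)
      qed
      ultimately show ?thesis
        using map_le_trans by (auto elim!: eventually_mono)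
    next
      case limit
      then obtain \<gamma> where \<gamma>: "\<gamma> \<in> C \<alpha>" "\<beta> < \<gamma>"
        using C_club[OF limit] \<open>\<beta> < \<alpha>\<close> unfolding club_in_def by blast
      then have "\<gamma> < \<alpha>" using C_lessD[OF limit] by blast
      have "\<forall>\<^sub>F i in cofinite. walk (C \<alpha>) L guess (path_hint (C \<alpha>) u i) \<gamma> = path (u |` {..<\<gamma>}) i"
        using IH \<gamma>(1) by (intro walk_eq_path[OF limit less.prems(1)]) auto
      moreover have "\<forall>\<^sub>F i in cofinite. path (u |` {..<\<beta>}) i \<subseteq>\<^sub>m path (u |` {..<\<gamma>}) i"
        using IH \<gamma>(2) \<open>\<gamma> < \<alpha>\<close> by simp
      ultimately show ?thesis
      proof eventually_elim
        case (elim i)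
        have "admissible \<alpha> (path_hint (C \<alpha>) u i)" unfolding admissible_def using less.prems by blast
        from walk_system.walk_le_limit[OF walk_system_at[OF limit this] \<gamma>(1)]
        have "path (u |` {..<\<gamma>}) i \<subseteq>\<^sub>m path u i"
          using elim(1) path_limit[OF limit du] unfolding lim_def by simp
        then show ?case using elim(2) map_le_trans by blast
      qed
    qed
  qed
qed

lemma path_last_value: "u \<in> level U (osuc p) \<Longrightarrow> path u i p = Some (h u i)"
  using path_osuc[OF dom_level] by simp

lemma level_is_node: "u \<in> level U \<alpha> \<Longrightarrow> is_node u"
  using dom_level unfolding is_node_def by blast

text \<open>Just above a place \<xi> where \<open>u\<close> and \<open>v\<close> differ, their path
  entries carry different labels at \<xi> for every \<open>i\<close>. By
  \<open>path_increasing\<close> almost all entries at level \<alpha> inherit these labels.\<close>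

lemma path_distinct:
  assumes u: "u \<in> level U \<alpha>" and v: "v \<in> level U \<alpha>" and "u \<noteq> v"
  shows "\<forall>\<^sub>F i in cofinite. path u i \<noteq> path v i"
proof -
  obtain \<xi> where \<xi>: "u \<xi> \<noteq> v \<xi>" using \<open>u \<noteq> v\<close> by blast
  then have "\<xi> < \<alpha>" using dom_level[OF u] dom_level[OF v] by (metis domIff lessThan_iff)
  then have le: "osuc \<xi> \<le> \<alpha>" by (rule osuc_le)
  let ?u = "u |` {..<osuc \<xi>}" and ?v = "v |` {..<osuc \<xi>}"
  have lev: "?u \<in> level U (osuc \<xi>)" "?v \<in> level U (osuc \<xi>)"
    using level_U_restrict[OF u le] level_U_restrict[OF v le] .
  have "?u \<noteq> ?v" using \<xi> less_osuc[of \<xi>] by (metis lessThan_iff restrict_in)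
  then have neq: "path ?u i \<xi> \<noteq> path ?v i \<xi>" for i
    using path_last_value[OF lev(1)] path_last_value[OF lev(2)] h_inj level_is_node lev by (metis option.inject)
  have defined: "\<xi> \<in> dom (path ?u i)" "\<xi> \<in> dom (path ?v i)" for i
    using path_last_value[OF lev(1)] path_last_value[OF lev(2)] by auto
  from path_increasing[OF u le] path_increasing[OF v le] show ?thesis
  proof eventually_elim
    case (elim i)
    then show ?case using neq[of i] defined unfolding map_le_def by metis
  qed
qed

lemma U_levelE:
  assumes "u \<in> U" obtains \<alpha> where "u \<in> level U \<alpha>"
  using assms U_closed unfolding downward_closed_def is_node_def level_def by blast

lemma ascent_path: "ascent_path T U path"
  unfolding ascent_path_def
proof (intro conjI ballI allI impI)
  fix u i assume "u \<in> U"
  then obtain \<alpha> where u: "u \<in> level U \<alpha>" by (rule U_levelE)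
  then show "path u i \<in> T" "dom (path u i) = dom u"
    using path_in_L[OF u, of i] dom_L dom_level[OF u] unfolding T_def by auto
next
  fix u v assume U: "u \<in> U" "v \<in> U" and uv: "u \<subseteq>\<^sub>m v \<and> u \<noteq> v"
  obtain \<alpha> where v: "v \<in> level U \<alpha>" using U(2) by (rule U_levelE)
  obtain \<beta> where u: "u \<in> level U \<beta>" using U(1) by (rule U_levelE)
  have "\<beta> \<le> \<alpha>"
    using map_le_implies_dom_le[of u v] uv dom_level[OF u] dom_level[OF v] by simp
  moreover have "\<beta> \<noteq> \<alpha>" using map_le_same_dom[of u v] uv dom_level[OF u] dom_level[OF v] by auto
  ultimately have "\<beta> < \<alpha>" by simp
  have u_eq: "v |` {..<\<beta>} = u" using map_le_iff_restrict[OF dom_level[OF u]] uv by blast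
  have "path u i \<noteq> path v i" for i
    using dom_L[OF path_in_L[OF u]] dom_L[OF path_in_L[OF v]] \<open>\<beta> \<noteq> \<alpha>\<close> by (metis lessThan_eq_iff)
  then show "{i. path u i \<subseteq>\<^sub>m path v i \<and> path u i \<noteq> path v i} \<in> Ffin"
    using path_increasing[OF v \<open>\<beta> \<le> \<alpha>\<close>] u_eq by (simp add: Collect_in_Ffin_iff)
next
  fix u v assume U: "u \<in> U" "v \<in> U" and uv: "u \<noteq> v \<and> dom u = dom v"
  obtain \<alpha> where v: "v \<in> level U \<alpha>" using U(2) by (rule U_levelE)
  then have "u \<in> level U \<alpha>" using U(1) uv unfolding level_def by auto
  then show "{i. path u i \<noteq> path v i} \<in> Ffin"
    using path_distinct v uv by (simp add: Collect_in_Ffin_iff)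
qed

lemma injective_ascent: "injective_ascent U path"
  unfolding injective_ascent_def
proof (intro allI impI)
  fix b :: "'k \<Rightarrow> 'k" assume b: "\<forall>\<alpha>. restr b \<alpha> \<in> U"
  \<comment> \<open>Any successor level serves, with \<open>I\<close> all of \<omega>: the labels at
    place \<open>p\<close> separate the entries.\<close>
  fix p :: 'k
  let ?u = "restr b (osuc p)"
  have "dom ?u = {..<osuc p}" by (auto simp: restr_def split: if_splits)
  then have u: "?u \<in> level U (osuc p)" using b by (simp add: level_def)
  have "inj_on (path ?u) UNIV"
  proof (rule inj_onI)
    fix i j assume "path ?u i = path ?u j"
    then have "h ?u i = h ?u j" using path_last_value[OF u] by (metis option.inject)
    then show "i = j" using h_inj level_is_node[OF u] by blast
  qed
  moreover have "UNIV \<in> Ffin" by (simp add: Ffin_def)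
  ultimately show "\<exists>\<alpha>. \<exists>I\<in>Ffin. inj_on (path (restr b \<alpha>)) I" by blast
qed

subsection \<open>Completeness\<close>

lemma T_downward_closed: "downward_closed T"
  unfolding downward_closed_def
proof (intro conjI ballI allI impI)
  fix x assume "x \<in> T"
  then obtain \<alpha> where x: "x \<in> L \<alpha>" unfolding T_def by blast
  then show "is_node x" using dom_L unfolding is_node_def by blast
  fix y assume y: "is_node y \<and> y \<subseteq>\<^sub>m x"
  then obtain \<beta> where d: "dom y = {..<\<beta>}" unfolding is_node_def by blast
  have "\<beta> \<le> \<alpha>" using map_le_implies_dom_le[of y x] y d dom_L[OF x] by simp
  then have "y \<in> L \<beta>" using L_restrict[OF x] map_le_iff_restrict[OF d] y by metis
  then show "y \<in> T" unfolding T_def by blast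
qed

lemma L_prolific: "x \<in> L \<alpha> \<Longrightarrow> i < omega_k \<or> i < \<alpha> \<Longrightarrow> x(\<alpha> \<mapsto> i) \<in> L (osuc \<alpha>)"
  unfolding L_osuc by blast

lemma prolific: "prolific T"
  unfolding prolific_def level_T using L_prolific unfolding T_def by blast

lemma T_is_node: "x \<in> T \<Longrightarrow> is_node x"
  using T_downward_closed unfolding downward_closed_def by blast

lemma L_in_T: "x \<in> L \<alpha> \<Longrightarrow> x \<in> T"
  unfolding T_def by blast

lemma in_L_height:
  assumes "x \<in> T" shows "x \<in> L (height x)"
proof -
  obtain \<alpha> where \<alpha>: "x \<in> L \<alpha>" using assms unfolding T_def by blast
  then have "height x = \<alpha>" by (intro height_eq dom_L)
  with \<alpha> show ?thesis by simp
qed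

text \<open>Without a last index, the heights of the \<open>s i\<close> are cofinal in their
  supremum \<alpha>, and there are too few of them for cofinality \<chi>. At such a level all
  branches were added, the union of the \<open>s i\<close> among them.\<close>

lemma chi_complete: "chi_complete T \<chi>"
  unfolding chi_complete_def
proof (intro allI impI)
  fix \<theta> :: 'k and s :: "'k \<Rightarrow> 'k node"
  assume *: "\<theta> < \<chi> \<and> (\<forall>i<\<theta>. s i \<in> T) \<and> (\<forall>i j. i < j \<and> j < \<theta> \<longrightarrow> s i \<subseteq>\<^sub>m s j \<and> s i \<noteq> s j)"
  then have \<theta>: "\<theta> < \<chi>" and sT: "\<And>i. i < \<theta> \<Longrightarrow> s i \<in> T"
    and incr: "\<And>i j. i < j \<Longrightarrow> j < \<theta> \<Longrightarrow> s i \<subseteq>\<^sub>m s j \<and> s i \<noteq> s j" by auto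
  have le: "s i \<subseteq>\<^sub>m s j" if "i \<le> j" "j < \<theta>" for i j
    using incr[of i j] that map_le_refl by (cases "i = j") auto
  consider "\<And>i. \<not> i < \<theta>" | m where "m < \<theta>" "\<And>i. i < \<theta> \<Longrightarrow> i \<le> m" |
    "\<exists>i. i < \<theta>" "\<And>i. i < \<theta> \<Longrightarrow> \<exists>j. i < j \<and> j < \<theta>"
    by (meson not_le)
  then show "\<exists>y\<in>T. \<forall>i<\<theta>. s i \<subseteq>\<^sub>m y"
  proof cases
    case 1
    then show ?thesis using L_nonempty L_in_T by blast
  next
    case (2 m)
    then show ?thesis using sT le by blast
  next
    case 3
    define \<eta> where "\<eta> i = height (s i)" for i
    have sL: "s i \<in> L (\<eta> i)" if "i < \<theta>" for i
      unfolding \<eta>_def by (rule in_L_height[OF sT[OF that]])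
    have dom_s: "dom (s i) = {..<\<eta> i}" if "i < \<theta>" for i
      using dom_L[OF sL[OF that]] .
    have \<eta>_mono: "\<eta> i < \<eta> j" if "i < j" "j < \<theta>" for i j
    proof -
      have "i < \<theta>" using that by simp
      have "\<eta> i \<le> \<eta> j"
        using map_le_implies_dom_le[of "s i" "s j"] incr[OF that] dom_s[OF that(2)] dom_s[OF \<open>i < \<theta>\<close>] by simp
      moreover have "\<eta> i \<noteq> \<eta> j"
        using map_le_same_dom[of "s i" "s j"] incr[OF that] dom_s[OF that(2)] dom_s[OF \<open>i < \<theta>\<close>] by auto
      ultimately show ?thesis by simp
    qed
    define X where "X = \<eta> ` {..<\<theta>}"
    define \<alpha> where "\<alpha> = (LEAST a. \<forall>i<\<theta>. \<eta> i < a)"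
    obtain a where "X \<subseteq> {..<a}"
      unfolding X_def by (rule small_bounded[OF small_image[OF lessThan_lesspoll]])
    then have "\<forall>i<\<theta>. \<eta> i < a" unfolding X_def by auto
    then have ub: "\<eta> i < \<alpha>" if "i < \<theta>" for i
      using LeastI[of "\<lambda>a. \<forall>i<\<theta>. \<eta> i < a" a] that unfolding \<alpha>_def by blast
    have least: "\<exists>i<\<theta>. \<beta> < \<eta> i" if "\<beta> < \<alpha>" for \<beta>
    proof -
      have "\<not> (\<forall>i<\<theta>. \<eta> i < \<beta>)"
        using not_less_Least[of \<beta> "\<lambda>a. \<forall>i<\<theta>. \<eta> i < a"] that unfolding \<alpha>_def by blast
      then obtain i where i: "i < \<theta>" "\<beta> \<le> \<eta> i" by (auto simp: not_less)
      then obtain j where "i < j" "j < \<theta>" using 3 by blast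
      then show ?thesis using i \<eta>_mono by (meson le_less_trans)
    qed
    have lim: "is_limit \<alpha>" unfolding is_limit_def using 3(1) ub least by blast
    have "X \<lesssim> {..<\<theta>}" unfolding X_def by (rule image_lepoll)
    moreover have "\<not> {..<\<chi>} \<lesssim> {..<\<theta>}"
      using chi_cardinal \<theta> unfolding is_cardinal_def lesspoll_iff_not_lepoll by blast
    ultimately have "\<not> {..<\<chi>} \<lesssim> X" using lepoll_trans by blast
    moreover have "X \<subseteq> {..<\<alpha>}" "\<forall>\<beta><\<alpha>. \<exists>\<gamma>\<in>X. \<beta> \<le> \<gamma>"
      unfolding X_def using ub least by (auto, meson lessThan_iff less_imp_le)
    ultimately have cf: "\<not> cf_ge \<alpha> \<chi>" unfolding cf_ge_def by blast
    \<comment> \<open>The sequence reindexed by heights, the form in which \<open>glue\<close> takes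
      its union.\<close>
    define w where "w \<gamma> = s (SOME i. i < \<theta> \<and> \<eta> i = \<gamma>)" for \<gamma>
    have w: "w (\<eta> i) = s i" if i: "i < \<theta>" for i
    proof -
      have "(SOME j. j < \<theta> \<and> \<eta> j = \<eta> i) = i"
      proof (rule some_equality)
        fix j assume "j < \<theta> \<and> \<eta> j = \<eta> i"
        then show "j = i" using \<eta>_mono i by (metis less_irrefl linorder_neqE)
      qed (simp add: i)
      then show ?thesis by (simp add: w_def)
    qed
    have tow: "tower X w \<alpha>"
      unfolding tower_def
    proof (intro conjI ballI impI)
      fix \<gamma> assume "\<gamma> \<in> X"
      then obtain i where "i < \<theta>" "\<gamma> = \<eta> i" unfolding X_def by blast
      then show "dom (w \<gamma>) = {..<\<gamma>}" using w dom_s by metis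
    next
      fix \<gamma> \<delta> assume "\<gamma> \<in> X" "\<delta> \<in> X" "\<gamma> < \<delta> \<and> \<delta> < \<alpha>"
      then obtain i j where ij: "i < \<theta>" "j < \<theta>" "\<gamma> = \<eta> i" "\<delta> = \<eta> j" "\<eta> i < \<eta> j"
        unfolding X_def by auto
      then have "i \<le> j" using \<eta>_mono[of j i] by (meson less_asym not_le)
      then show "w \<gamma> \<subseteq>\<^sub>m w \<delta>" using le ij w by simp
    qed
    define y where "y = glue X w \<alpha>"
    have up: "s i \<subseteq>\<^sub>m y" if "i < \<theta>" for i
      using glue_upper[OF tow, of "\<eta> i"] ub[OF that] w[OF that] that unfolding y_def X_def by auto
    have dom_y: "dom y = {..<\<alpha>}"
      unfolding y_def using least ub by (intro dom_glue[OF tow]) (auto simp: X_def)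
    have "y |` {..<\<beta>} \<in> L \<beta>" if \<beta>: "\<beta> < \<alpha>" for \<beta>
    proof -
      obtain i where i: "i < \<theta>" "\<beta> < \<eta> i" using least[OF \<beta>] by blast
      have "y |` {..<\<eta> i} = s i" using map_le_iff_restrict[OF dom_s[OF i(1)]] up[OF i(1)] by blast
      then have "s i |` {..<\<beta>} = (y |` {..<\<eta> i}) |` {..<\<beta>}" by (simp only:)
      also have "\<dots> = y |` ({..<\<eta> i} \<inter> {..<\<beta>})" by (rule Map.restrict_restrict)
      also have "{..<\<eta> i} \<inter> {..<\<beta>} = {..<\<beta>}" using i(2) by auto
      finally have "y |` {..<\<beta>} = s i |` {..<\<beta>}" ..
      then show ?thesis using L_restrict[OF sL[OF i(1)]] i(2) by (simp add: less_imp_le)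
    qed
    then have "y \<in> L \<alpha>"
      unfolding L_limit_iff[OF lim] using cf dom_y by simp
    then show ?thesis using up L_in_T by blast
  qed
qed

subsection \<open>Sealing antichains\<close>

lemma kappa_tree: "kappa_tree T"
  unfolding kappa_tree_def level_T using L_nonempty L_small by blast

text \<open>Since the club is unbounded, each of its points has a next one; iterating this from
  \<beta> gives finite stretches of any length.\<close>

lemma long_block:
  assumes lim: "is_limit \<alpha>" and \<beta>: "\<beta> \<in> C \<alpha>"
  shows "\<exists>\<delta>\<in>C \<alpha>. \<beta> < \<delta> \<and> finite (C \<alpha> \<inter> {\<beta>..<\<delta>}) \<and> n < card (C \<alpha> \<inter> {\<beta>..<\<delta>})"
proof -
  have nxt: "\<exists>\<delta>\<in>C \<alpha>. \<gamma> < \<delta> \<and> C \<alpha> \<inter> {\<beta>..<\<delta>} = insert \<gamma> (C \<alpha> \<inter> {\<beta>..<\<gamma>})"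
    if \<gamma>: "\<gamma> \<in> C \<alpha>" "\<beta> \<le> \<gamma>" for \<gamma>
  proof -
    have ex: "\<exists>\<delta>. \<delta> \<in> C \<alpha> \<and> \<gamma> < \<delta>"
      using C_club[OF lim] C_lessD[OF lim \<gamma>(1)] unfolding club_in_def by blast
    define \<delta> where "\<delta> = (LEAST \<delta>. \<delta> \<in> C \<alpha> \<and> \<gamma> < \<delta>)"
    have \<delta>: "\<delta> \<in> C \<alpha>" "\<gamma> < \<delta>" unfolding \<delta>_def using LeastI_ex[OF ex] by auto
    have "\<epsilon> < \<delta> \<longleftrightarrow> \<epsilon> = \<gamma> \<or> \<epsilon> < \<gamma>" if "\<epsilon> \<in> C \<alpha>" for \<epsilon>
      using not_less_Least[of \<epsilon> "\<lambda>\<delta>. \<delta> \<in> C \<alpha> \<and> \<gamma> < \<delta>"] that \<delta>(2) unfolding \<delta>_def[symmetric] by auto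
    then have "C \<alpha> \<inter> {\<beta>..<\<delta>} = insert \<gamma> (C \<alpha> \<inter> {\<beta>..<\<gamma>})"
      using \<gamma> by auto
    then show ?thesis using \<delta> by blast
  qed
  show ?thesis
  proof (induction n)
    case 0
    obtain \<delta> where "\<delta> \<in> C \<alpha>" "\<beta> < \<delta>" "C \<alpha> \<inter> {\<beta>..<\<delta>} = {\<beta>}"
      using nxt[OF \<beta> order_refl] by auto
    then show ?case by (intro bexI[of _ \<delta>]) auto
  next
    case (Suc n)
    then obtain \<gamma> where \<gamma>: "\<gamma> \<in> C \<alpha>" "\<beta> < \<gamma>" "finite (C \<alpha> \<inter> {\<beta>..<\<gamma>})" "n < card (C \<alpha> \<inter> {\<beta>..<\<gamma>})"
      by blast
    obtain \<delta> where "\<delta> \<in> C \<alpha>" "\<gamma> < \<delta>" "C \<alpha> \<inter> {\<beta>..<\<delta>} = insert \<gamma> (C \<alpha> \<inter> {\<beta>..<\<gamma>})"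
      using nxt[OF \<gamma>(1) less_imp_le[OF \<gamma>(2)]] by blast
    then show ?case using \<gamma> by (intro bexI[of _ \<delta>]) auto
  qed
qed

text \<open>Used to see that a point of the club finitely many steps above \<beta> is no
  accumulation point, so that \<open>walk_meets\<close> applies to it.\<close>

lemma infinite_below_acc:
  assumes "\<delta> \<in> acc D" "\<beta> < \<delta>" shows "infinite (D \<inter> {\<beta>..<\<delta>})"
proof
  assume fin: "finite (D \<inter> {\<beta>..<\<delta>})"
  have next_elem: "\<exists>\<epsilon>\<in>D. \<gamma> < \<epsilon> \<and> \<epsilon> < \<delta>" if "\<gamma> < \<delta>" for \<gamma>
    using assms(1) that unfolding acc_def by blast
  obtain \<epsilon> where "\<epsilon> \<in> D" "\<beta> < \<epsilon>" "\<epsilon> < \<delta>" using next_elem[OF assms(2)] by blast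
  then have ne: "D \<inter> {\<beta>..<\<delta>} \<noteq> {}" by auto
  let ?m = "Max (D \<inter> {\<beta>..<\<delta>})"
  have m: "?m \<in> D \<inter> {\<beta>..<\<delta>}" by (rule Max_in[OF fin ne])
  then obtain \<epsilon> where "\<epsilon> \<in> D" "?m < \<epsilon>" "\<epsilon> < \<delta>" using next_elem[of ?m] by auto
  then have "\<epsilon> \<in> D \<inter> {\<beta>..<\<delta>}" using m by auto
  then show False using Max_ge[OF fin] \<open>?m < \<epsilon>\<close> by (meson not_less)
qed

text \<open>Every admissible hint function falls silent at some point of \<open>B\<close>: climbing
  hints stop above the height of their node, and path hints stop after position \<open>i\<close> of
  each block, while stretches inside \<open>B\<close> occur cofinally and reach every finite
  position.\<close>

lemma admissible_None_in_block:
  assumes lim: "is_limit \<alpha>" and adm: "admissible \<alpha> H"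
    and hits: "\<And>\<gamma>. \<gamma> < \<alpha> \<Longrightarrow> \<exists>\<beta>\<in>C \<alpha>. \<gamma> < \<beta> \<and> succ_omega (C \<alpha> - {..<\<beta>}) \<subseteq> B"
  obtains \<beta> \<delta> where "\<beta> \<in> C \<alpha>" "\<delta> \<in> C \<alpha>" "\<beta> < \<delta>" "\<delta> \<notin> acc (C \<alpha>)" "\<delta> \<in> B" "H \<delta> = None"
proof -
  have block: "\<exists>\<beta>\<in>C \<alpha>. \<exists>\<delta>\<in>C \<alpha>. \<gamma> < \<beta> \<and> \<beta> < \<delta> \<and> \<delta> \<notin> acc (C \<alpha>) \<and> \<delta> \<in> B \<and> n < block_pos (C \<alpha>) \<delta>"
    if "\<gamma> < \<alpha>" for \<gamma> n
  proof -
    obtain \<beta> where \<beta>: "\<beta> \<in> C \<alpha>" "\<gamma> < \<beta>" "succ_omega (C \<alpha> - {..<\<beta>}) \<subseteq> B" using hits[OF \<open>\<gamma> < \<alpha>\<close>] by blast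
    obtain \<delta> where \<delta>: "\<delta> \<in> C \<alpha>" "\<beta> < \<delta>" "finite (C \<alpha> \<inter> {\<beta>..<\<delta>})" "n < card (C \<alpha> \<inter> {\<beta>..<\<delta>})"
      using long_block[OF lim \<beta>(1)] by blast
    have "(C \<alpha> - {..<\<beta>}) \<inter> {..<\<delta>} = C \<alpha> \<inter> {\<beta>..<\<delta>}" by auto
    moreover have "C \<alpha> \<inter> {\<beta>..<\<delta>} \<noteq> {}" using \<beta>(1) \<delta>(2) by auto
    ultimately have "\<delta> \<in> succ_omega (C \<alpha> - {..<\<beta>})"
      unfolding succ_omega_def using \<delta> by auto
    moreover have "\<delta> \<notin> acc (C \<alpha>)" using infinite_below_acc \<delta> by blast
    moreover have "n < block_pos (C \<alpha>) \<delta>" using card_le_block_pos[OF \<delta>(3)] \<delta>(4) by simp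
    ultimately show ?thesis using \<beta> \<delta> by blast
  qed
  from adm consider \<gamma> x where "\<gamma> \<in> C \<alpha>" "x \<in> L \<gamma>" "H = node_hint x" |
    u i where "u \<in> level U \<alpha>" "H = path_hint (C \<alpha>) u i"
    unfolding admissible_def by blast
  then show ?thesis
  proof cases
    case (1 \<gamma> x)
    obtain \<beta> \<delta> where *: "\<beta> \<in> C \<alpha>" "\<delta> \<in> C \<alpha>" "\<gamma> < \<beta>" "\<beta> < \<delta>" "\<delta> \<notin> acc (C \<alpha>)" "\<delta> \<in> B"
      using block[OF C_lessD[OF lim 1(1)]] by blast
    then have "\<not> {..<\<delta>} \<subseteq> dom x" using dom_L[OF 1(2)] by (simp add: not_le)
    then have "H \<delta> = None" using 1(3) by (simp add: node_hint_def)
    then show ?thesis using that * by blast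
  next
    case (2 u i)
    obtain \<gamma> where "\<gamma> < \<alpha>" using lim unfolding is_limit_def by blast
    then obtain \<beta> \<delta> where *: "\<beta> \<in> C \<alpha>" "\<delta> \<in> C \<alpha>" "\<beta> < \<delta>" "\<delta> \<notin> acc (C \<alpha>)" "\<delta> \<in> B" "i < block_pos (C \<alpha>) \<delta>"
      using block by blast
    then have "H \<delta> = None" using 2(2) by (simp add: path_hint_def)
    then show ?thesis using that * by blast
  qed
qed

text \<open>By diamond, good guesses of \<open>D\<close> occur cofinally, and the hitting property
  of \<open>C\<close> gives an \<alpha> of cofinality at least \<chi> whose club runs through them
  in blocks. At such \<alpha> every node is the limit of an admissible walk, which is without hint
  at some good guess and there moves above an element of \<open>D\<close>.\<close>

lemma dense_sealed:
  assumes "D \<subseteq> T" and dense: "\<And>y. y \<in> T \<Longrightarrow> \<exists>z\<in>D. y \<subseteq>\<^sub>m z"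
  obtains \<alpha> where "\<And>z. z \<in> L \<alpha> \<Longrightarrow> \<exists>\<gamma><\<alpha>. \<exists>d\<in>D \<inter> L \<gamma>. d \<subseteq>\<^sub>m z"
proof -
  obtain d where d: "\<And>y. y \<in> T \<Longrightarrow> d y \<in> D \<and> y \<subseteq>\<^sub>m d y" using dense by metis
  have "\<exists>a. \<forall>y\<in>L \<gamma>. height (d y) < a \<and> c (d y) < a" for \<gamma>
  proof -
    obtain a where "(\<lambda>y. height (d y)) ` L \<gamma> \<union> (\<lambda>y. c (d y)) ` L \<gamma> \<subseteq> {..<a}"
      by (rule small_bounded[OF small_Un[OF small_image[OF L_small] small_image[OF L_small]]])
    then show ?thesis by (intro exI[of _ a]) auto
  qed
  \<comment> \<open>\<open>F\<close> bounds heights and codes of the chosen extensions, so density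
    of \<open>D\<close> reflects to every \<beta> closed under \<open>F\<close>.\<close>
  then obtain F where F: "\<And>\<gamma> y. y \<in> L \<gamma> \<Longrightarrow> height (d y) < F \<gamma> \<and> c (d y) < F \<gamma>" by metis
  \<comment> \<open>The good guesses: only elements of \<open>D\<close> are guessed at \<beta>, and
    they are dense below \<beta>, as \<open>walk_meets\<close> asks.\<close>
  define B where "B = {\<beta>. guess \<beta> \<subseteq> D \<and> (\<forall>\<gamma> y. \<gamma> < \<beta> \<longrightarrow> y \<in> L \<gamma> \<longrightarrow>
      (\<exists>\<epsilon><\<beta>. \<exists>z\<in>L \<epsilon>. z \<in> guess \<beta> \<and> y \<subseteq>\<^sub>m z))}"
  have B_cofinal: "\<exists>\<beta>\<in>B. \<beta>0 \<le> \<beta>" for \<beta>0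
  proof -
    obtain \<beta> where \<beta>: "c ` D \<inter> {..<\<beta>} = A \<beta>" "\<beta>0 < \<beta>" "\<And>\<gamma>. \<gamma> < \<beta> \<Longrightarrow> F \<gamma> < \<beta>"
      using A_guesses[of "c ` D"] club_closed_under[of \<beta>0 F] unfolding stationary_def by blast
    have "guess \<beta> \<subseteq> D"
    proof
      fix a assume "a \<in> guess \<beta>"
      then have "a \<in> T" "c a \<in> c ` D" using \<beta>(1) L_in_T unfolding guess_def by auto
      then obtain a' where "a' \<in> D" "c a = c a'" by blast
      then show "a \<in> D"
        using inj_onD[OF c_inj] T_is_node \<open>a \<in> T\<close> assms(1) by (metis mem_Collect_eq subsetD)
    qed
    moreover have "\<exists>\<epsilon><\<beta>. \<exists>z\<in>L \<epsilon>. z \<in> guess \<beta> \<and> y \<subseteq>\<^sub>m z" if "\<gamma> < \<beta>" "y \<in> L \<gamma>" for \<gamma> y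
    proof -
      have dy: "d y \<in> D" "y \<subseteq>\<^sub>m d y" using d[OF L_in_T[OF that(2)]] by auto
      have h: "height (d y) < \<beta>" "c (d y) < \<beta>" using F[OF that(2)] \<beta>(3)[OF that(1)] by auto
      have "d y \<in> L (height (d y))" using in_L_height dy(1) assms(1) by blast
      moreover have "c (d y) \<in> A \<beta>" using \<beta>(1) dy(1) h(2) by blast
      ultimately have "d y \<in> guess \<beta>" unfolding guess_def using h(1) by blast
      then show ?thesis using \<open>d y \<in> L (height (d y))\<close> h(1) dy(2) by blast
    qed
    ultimately show ?thesis unfolding B_def using \<beta>(2) by (intro bexI[of _ \<beta>]) auto
  qed
  \<comment> \<open>Meeting a club of limit ordinals makes \<alpha> a limit;
    \<open>undefined\<close> stands for an arbitrary lower bound.\<close>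
  obtain \<alpha> where \<alpha>: "\<alpha> \<in> E_ge \<chi>" "is_limit \<alpha>"
    "\<And>\<gamma>. \<gamma> < \<alpha> \<Longrightarrow> \<exists>\<beta>\<in>C \<alpha>. \<gamma> < \<beta> \<and> succ_omega (C \<alpha> - {..<\<beta>}) \<subseteq> B"
    using C_hits[OF B_cofinal] club_closed_under[of undefined id] unfolding stationary_def by blast
  have "\<exists>\<gamma><\<alpha>. \<exists>d\<in>D \<inter> L \<gamma>. d \<subseteq>\<^sub>m z" if z: "z \<in> L \<alpha>" for z
  proof -
    have "cf_ge \<alpha> \<chi>" using \<alpha>(1) unfolding E_ge_def by blast
    then obtain H where H: "admissible \<alpha> H" "z = lim \<alpha> H" using L_limit_iff[OF \<alpha>(2)] z by blast
    interpret walk_system \<alpha> "C \<alpha>" L guess H by (rule walk_system_at[OF \<alpha>(2) H(1)])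
    obtain \<beta> \<delta> where \<delta>: "\<beta> \<in> C \<alpha>" "\<delta> \<in> C \<alpha>" "\<beta> < \<delta>" "\<delta> \<notin> acc (C \<alpha>)" "\<delta> \<in> B" "H \<delta> = None"
      using admissible_None_in_block[OF \<alpha>(2) H(1) \<alpha>(3)] .
    have B: "guess \<delta> \<subseteq> D" "\<And>\<gamma> y. \<gamma> < \<delta> \<Longrightarrow> y \<in> L \<gamma> \<Longrightarrow> \<exists>\<epsilon><\<delta>. \<exists>z\<in>L \<epsilon>. z \<in> guess \<delta> \<and> y \<subseteq>\<^sub>m z"
      using \<delta>(5) unfolding B_def by auto
    have "\<exists>a\<in>guess \<delta>. a \<subseteq>\<^sub>m w \<delta>"
      by (rule walk_meets[OF \<delta>(2,4,1,3,6)]) (rule B(2))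
    then obtain a where a: "a \<in> guess \<delta>" "a \<subseteq>\<^sub>m w \<delta>" by blast
    obtain \<gamma> where "\<gamma> < \<delta>" "a \<in> L \<gamma>" using a(1) unfolding guess_def by blast
    moreover have "a \<subseteq>\<^sub>m z"
      using map_le_trans[OF a(2) walk_le_limit[OF \<delta>(2)]] unfolding H(2) lim_def .
    moreover have "\<delta> < \<alpha>" using C_less[OF \<delta>(2)] .
    ultimately show ?thesis using a(1) B(1) by (meson IntI less_trans subsetD)
  qed
  then show ?thesis by (rule that)
qed

text \<open>Suppose \<open>a\<close> in \<open>X\<close> had height at least the level \<alpha> that
  seals \<open>D\<close>. Then \<open>a\<close> lies above some \<open>d\<close> in \<open>D\<close>
  of height below \<alpha>. Being compatible with \<open>a\<close>, this \<open>d\<close> lies above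
  an element of \<open>X\<close>, which can only be \<open>a\<close>; so \<open>a\<close> has height
  below \<alpha> after all.\<close>

lemma antichain_small:
  assumes "antichain T X" shows "small K X"
proof -
  have XT: "X \<subseteq> T" and anti: "\<And>x y. x \<in> X \<Longrightarrow> y \<in> X \<Longrightarrow> x \<subseteq>\<^sub>m y \<Longrightarrow> x = y"
    using assms unfolding antichain_def by blast+
  define D where "D = {z \<in> T. (\<exists>a\<in>X. a \<subseteq>\<^sub>m z) \<or> (\<forall>a\<in>X. \<not> a \<subseteq>\<^sub>m z \<and> \<not> z \<subseteq>\<^sub>m a)}"
  have "\<exists>z\<in>D. y \<subseteq>\<^sub>m z" if y: "y \<in> T" for y
  proof (cases "\<exists>a\<in>X. y \<subseteq>\<^sub>m a")
    case True
    then show ?thesis unfolding D_def using XT map_le_refl by blast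
  next
    case False
    then have "y \<in> D" unfolding D_def using y by blast
    then show ?thesis using map_le_refl by blast
  qed
  then obtain \<alpha> where \<alpha>: "\<And>z. z \<in> L \<alpha> \<Longrightarrow> \<exists>\<gamma><\<alpha>. \<exists>d\<in>D \<inter> L \<gamma>. d \<subseteq>\<^sub>m z"
    using dense_sealed[of D] unfolding D_def by blast
  have "X \<subseteq> (\<Union>\<gamma><\<alpha>. L \<gamma>)"
  proof
    fix a assume a: "a \<in> X"
    define \<gamma> where "\<gamma> = height a"
    have aL: "a \<in> L \<gamma>" unfolding \<gamma>_def using in_L_height a XT by blast
    have "\<gamma> < \<alpha>"
    proof (rule ccontr)
      assume "\<not> \<gamma> < \<alpha>"
      then have "a |` {..<\<alpha>} \<in> L \<alpha>" using L_restrict[OF aL] by simp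
      then obtain \<epsilon> d where d: "\<epsilon> < \<alpha>" "d \<in> D" "d \<in> L \<epsilon>" "d \<subseteq>\<^sub>m a |` {..<\<alpha>}" using \<alpha> by blast
      have da: "d \<subseteq>\<^sub>m a" using map_le_trans[OF d(4) restrict_map_le] .
      then obtain a' where a': "a' \<in> X" "a' \<subseteq>\<^sub>m d" using d(2) a unfolding D_def by blast
      then have "a \<subseteq>\<^sub>m d" using anti[OF a'(1) a] map_le_trans[OF a'(2) da] by blast
      then have "\<gamma> \<le> \<epsilon>" using map_le_implies_dom_le[of a d] dom_L[OF aL] dom_L[OF d(3)] by simp
      then show False using d(1) \<open>\<not> \<gamma> < \<alpha>\<close> by simp
    qed
    then show "a \<in> (\<Union>\<gamma><\<alpha>. L \<gamma>)" using aL by blast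
  qed
  then show ?thesis
    by (rule small_subset[OF _ small_UN[OF lessThan_lesspoll L_small]])
qed

text \<open>In a prolific tree one can leave the branch at every level by a one-step extension; the
  nodes obtained form an antichain of size \<kappa>.\<close>

lemma no_cofinal_branch: "\<not> cofinal_branch T B"
proof
  assume B: "cofinal_branch T B"
  then have "\<exists>x. x \<in> B \<and> x \<in> L \<alpha>" for \<alpha> unfolding cofinal_branch_def level_T by blast
  then obtain b where b: "\<And>\<alpha>. b \<alpha> \<in> B" "\<And>\<alpha>. b \<alpha> \<in> L \<alpha>" by metis
  have comparable: "b \<alpha> \<xi> = b \<beta> \<xi>" if "\<xi> < \<alpha>" "\<xi> < \<beta>" for \<alpha> \<beta> \<xi>
  proof -
    have "b \<alpha> \<subseteq>\<^sub>m b \<beta> \<or> b \<beta> \<subseteq>\<^sub>m b \<alpha>" using B b(1) unfolding cofinal_branch_def by blast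
    then show ?thesis
      using that dom_L[OF b(2)] unfolding map_le_def by (metis lessThan_iff)
  qed
  \<comment> \<open>There are infinitely many labels below \<omega>, and the branch uses just one of
    them at place \<alpha>.\<close>
  have "\<exists>i<omega_k. Some i \<noteq> b (osuc \<alpha>) \<alpha>" for \<alpha>
  proof -
    have "infinite {..<(omega_k::'k)}"
      unfolding omega_k_def by (rule LeastI[of "\<lambda>a. infinite {..<a}", OF chi_infinite])
    then have "{..<omega_k} - {the (b (osuc \<alpha>) \<alpha>)} \<noteq> {}" by (metis finite.emptyI infinite_remove)
    then show ?thesis by (metis DiffE all_not_in_conv lessThan_iff option.sel singletonI)
  qed
  then obtain i where i: "\<And>\<alpha>. i \<alpha> < omega_k" "\<And>\<alpha>. Some (i \<alpha>) \<noteq> b (osuc \<alpha>) \<alpha>" by metis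
  define x where "x \<alpha> = (b \<alpha>)(\<alpha> \<mapsto> i \<alpha>)" for \<alpha>
  have xL: "x \<alpha> \<in> L (osuc \<alpha>)" for \<alpha>
    unfolding x_def using L_prolific b(2) i(1) by blast
  have le_imp_eq: "\<alpha> = \<beta>" if le: "x \<alpha> \<subseteq>\<^sub>m x \<beta>" for \<alpha> \<beta>
  proof (rule ccontr)
    assume "\<alpha> \<noteq> \<beta>"
    have "{..<osuc \<alpha>} \<subseteq> {..<osuc \<beta>}"
      using map_le_implies_dom_le[OF le] dom_L[OF xL] by simp
    then have "\<alpha> < \<beta>" using \<open>\<alpha> \<noteq> \<beta>\<close> unfolding lessThan_osuc by auto
    have "x \<beta> \<alpha> = x \<alpha> \<alpha>" using le unfolding map_le_def x_def by auto
    then have "b \<beta> \<alpha> = Some (i \<alpha>)" using \<open>\<alpha> \<noteq> \<beta>\<close> by (simp add: x_def)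
    then show False using comparable[OF \<open>\<alpha> < \<beta>\<close> less_osuc] i(2)[of \<alpha>] by simp
  qed
  have "antichain T (range x)"
    unfolding antichain_def using le_imp_eq xL L_in_T by blast
  then have "small K (range x)" by (rule antichain_small)
  moreover have "inj x" using le_imp_eq map_le_refl by (metis injI)
  then have "range x \<approx> (UNIV :: 'k set)" by (simp add: inj_on_image_eqpoll_self)
  ultimately show False unfolding lesspoll_def by blast
qed

lemma kappa_souslin: "kappa_souslin T"
  unfolding kappa_souslin_def
  using kappa_tree no_cofinal_branch antichain_small unfolding lesspoll_def by blast

end

theorem theorem4p3:
  fixes \<chi> :: "'k::wellorder" and U :: "'k node set"
  assumes kappa_uncountable: "uncountable (UNIV :: 'k set)"
    and kappa_cardinal: "\<forall>a::'k. {..<a} \<prec> (UNIV :: 'k set)"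
    and kappa_regular: "\<forall>X::'k set. (\<forall>a. \<exists>x\<in>X. a \<le> x) \<longrightarrow> X \<approx> (UNIV :: 'k set)"
    and chi_infinite: "infinite {..<\<chi>}"
    and chi_cardinal: "is_cardinal \<chi>"
    and U_tree: "downward_closed U" "kappa_tree U"
    and P14: "P14 (E_ge \<chi>)"
    and arith: "\<forall>lam::'k. short_funs lam \<chi> \<prec> (UNIV :: 'k set)"
  shows "\<exists>T :: 'k node set. downward_closed T \<and> prolific T \<and> chi_complete T \<chi> \<and>
           kappa_souslin T \<and> (\<exists>f. ascent_path T U f \<and> injective_ascent U f)"
proof -
  interpret regular_uncountable "TYPE('k)"
    using kappa_uncountable kappa_cardinal kappa_regular by unfold_locales auto
  from P14[unfolded P14_def] obtain C :: "'k \<Rightarrow> 'k set" where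
    C1: "\<forall>\<alpha>. is_limit \<alpha> \<longrightarrow> club_in (C \<alpha>) \<alpha>"
    and C2: "\<forall>\<alpha>. \<forall>\<gamma>\<in>acc (C \<alpha>). C \<gamma> = C \<alpha> \<inter> {..<\<gamma>}"
    and C3: "\<forall>B. (\<forall>\<beta>. \<exists>\<gamma>\<in>B. \<beta> \<le> \<gamma>) \<longrightarrow> stationary {\<alpha>\<in>E_ge \<chi>. \<forall>\<gamma><\<alpha>. \<exists>\<beta>\<in>C \<alpha>. \<gamma> < \<beta> \<and>
                         succ_omega (C \<alpha> - {..<\<beta>}) \<subseteq> B}"
    by (elim conjE exE)
  obtain A :: "'k \<Rightarrow> 'k set" where A: "\<And>Z. stationary {\<alpha>. Z \<inter> {..<\<alpha>} = A \<alpha>}"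
    using P14[unfolded P14_def, THEN conjunct1] unfolding diamond_def by blast
  obtain c :: "'k node \<Rightarrow> 'k" where c: "inj_on c {x. is_node x}"
    using ex_node_coding[OF A] by blast
  obtain p :: "'k \<times> 'k \<Rightarrow> 'k" where p: "inj p" using ex_pairing by blast
  obtain e :: "nat \<Rightarrow> 'k" where e: "inj e" using ex_nat_injection by blast
  \<comment> \<open>A label pairs the code of \<open>u\<close> with a copy of \<open>i\<close> in
    \<kappa>, which makes it injective in both arguments on nodes.\<close>
  interpret souslin_construction "TYPE('k)" \<chi> U C A c "\<lambda>u i. p (c u, e i)"
  proof unfold_locales
    fix u v :: "'k node" and i j
    assume "is_node u" "is_node v" "p (c u, e i) = p (c v, e j)"
    then show "u = v \<and> i = j"
      using inj_onD[OF c] injD[OF p] injD[OF e] by (metis mem_Collect_eq prod.inject)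
  next
    show "level U \<alpha> \<prec> (UNIV :: 'k set)" for \<alpha> using U_tree(2) unfolding kappa_tree_def by blast
    show "short_funs lam \<chi> \<prec> (UNIV :: 'k set)" for lam using arith by blast
    show "club_in (C \<alpha>) \<alpha>" if "is_limit \<alpha>" for \<alpha> using C1 that by blast
    show "C \<gamma> = C \<alpha> \<inter> {..<\<gamma>}" if "\<gamma> \<in> acc (C \<alpha>)" for \<alpha> \<gamma> using C2[rule_format, OF that] .
    show "stationary {\<alpha>\<in>E_ge \<chi>. \<forall>\<gamma><\<alpha>. \<exists>\<beta>\<in>C \<alpha>. \<gamma> < \<beta> \<and> succ_omega (C \<alpha> - {..<\<beta>}) \<subseteq> B}"
      if "\<And>\<beta>. \<exists>\<gamma>\<in>B. \<beta> \<le> \<gamma>" for B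
      using C3[rule_format, OF that] .
  qed (fact chi_infinite chi_cardinal U_tree(1) A c)+
  show ?thesis
    using T_downward_closed prolific chi_complete kappa_souslin ascent_path injective_ascent by blast
qed

end
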